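(* Let $G$ be an outerplanar graph. Then $Z_+(G)=\mathrm{T}(G)$. Moreover, for every family $\mathcal T$ of $\mathrm{T}(G)$ vertex-disjoint induced trees of $G$ covering $V(G)$, there is a positive zero forcing set of $G$ of size $Z_+(G)$ and a positive zero forcing process starting from it whose forcing trees are exactly the trees of $\mathcal T$.
   Context: All graphs are finite, simple and undirected. A graph is outerplanar if it has a planar embedding in which all vertices lie on the outer face. Positive semidefinite colour change rule: vertices are coloured black or white; let $B$ be the set of black vertices and $W_1,\dots,W_r$ the vertex sets of the components of $G-B$; if $u\in B$ and $w\in W_i$ is the only white neighbour of $u$ in the subgraph induced by $B\cup W_i$, then $u$ forces $w$, i.e. $w$ is recoloured black. A positive zero forcing set is a set of initially black vertices (all others white) from which repeated application of this rule colours all vertices black; $Z_+(G)$ is the minimum size of such a set. In a positive zero forcing process starting from a positive zero forcing set $Z_p$, every vertex outside $Z_p$ is forced by exactly one vertex; for $r\in Z_p$, the forcing tree rooted at $r$ is the subgraph induced by $r$ together with all vertices reachable from $r$ by a sequence of forces $r\to u_1\to u_2\to\cdots$; the forcing trees partition $V(G)$. The tree cover number $\mathrm{T}(G)$ is the minimum number of vertex-disjoint induced trees of $G$ covering $V(G)$. *)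

theory Defs
  imports "HOL-Analysis.Analysis" "Graph_Theory.Graph_Theory"
begin

text \<open>
  Following the Graph_Theory library, a finite simple undirected graph is a
  \<^locale>\<open>graph\<close>: a finite, loop-free, symmetric digraph without parallel arcs.  An undirected
  edge is thus a pair of mutually opposite arcs.
\<close>

section \<open>Outerplanar graphs\<close>

text \<open>
  A planar embedding places the vertices at distinct points \<open>p v\<close> of the plane and draws each arc
  \<open>e\<close> as a simple curve \<open>c e\<close>.  The two opposite arcs of an edge are drawn as one point set, and the
  drawings of two different edges meet only in common end points.
\<close>

definition planar_embedding ::
  "('a,'b) pre_digraph \<Rightarrow> ('a \<Rightarrow> complex) \<Rightarrow> ('b \<Rightarrow> real \<Rightarrow> complex) \<Rightarrow> bool" where
  "planar_embedding G p c \<longleftrightarrow>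
     inj_on p (verts G) \<and>
     (\<forall>e\<in>arcs G. arc (c e) \<and> pathstart (c e) = p (tail G e) \<and> pathfinish (c e) = p (head G e) \<and>
        path_image (c e) \<inter> p ` verts G = {p (tail G e), p (head G e)}) \<and>
     (\<forall>e\<in>arcs G. \<forall>e'\<in>arcs G.
        if {tail G e, head G e} = {tail G e', head G e'}
        then path_image (c e) = path_image (c e')
        else path_image (c e) \<inter> path_image (c e')
               \<subseteq> p ` ({tail G e, head G e} \<inter> {tail G e', head G e'}))"

definition drawing ::
  "('a,'b) pre_digraph \<Rightarrow> ('a \<Rightarrow> complex) \<Rightarrow> ('b \<Rightarrow> real \<Rightarrow> complex) \<Rightarrow> complex set" where
  "drawing G p c = p ` verts G \<union> (\<Union>e\<in>arcs G. path_image (c e))"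

text \<open>
  The outer face is the unbounded component of the complement of the drawing; a vertex lies on it
  if it is a boundary point of it.
\<close>

definition outerplanar :: "('a,'b) pre_digraph \<Rightarrow> bool" where
  "outerplanar G \<longleftrightarrow>
     (\<exists>p c. planar_embedding G p c \<and> p ` verts G \<subseteq> frontier (outside (drawing G p c)))"


section \<open>Positive semidefinite zero forcing\<close>

text \<open>
  \<open>B\<close> is the set of black vertices.  Since \<open>G\<close> is symmetric, the strongly connected components of
  \<open>G - B\<close> are its components.
\<close>

definition psd_forces :: "('a,'b) pre_digraph \<Rightarrow> 'a set \<Rightarrow> 'a \<Rightarrow> 'a \<Rightarrow> bool" where
  "psd_forces G B u w \<longleftrightarrow>
     u \<in> B \<and>
     (\<exists>W\<in>pre_digraph.sccs_verts (G \<restriction> (verts G - B)).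
        w \<in> W \<and> {x \<in> verts G - B. u \<rightarrow>\<^bsub>G \<restriction> (B \<union> W)\<^esub> x} = {w})"

text \<open>
  A process from the black set \<open>B\<close> is the chronological list of its forces \<open>u \<rightarrow> w\<close>, performed one
  at a time until all vertices are black.
\<close>

fun psd_forcing_process :: "('a,'b) pre_digraph \<Rightarrow> 'a set \<Rightarrow> ('a \<times> 'a) list \<Rightarrow> bool" where
  "psd_forcing_process G B [] \<longleftrightarrow> B = verts G"
| "psd_forcing_process G B ((u, w) # fs) \<longleftrightarrow>
     psd_forces G B u w \<and> psd_forcing_process G (insert w B) fs"

definition psd_forcing_set :: "('a,'b) pre_digraph \<Rightarrow> 'a set \<Rightarrow> bool" where
  "psd_forcing_set G Z \<longleftrightarrow> Z \<subseteq> verts G \<and> (\<exists>fs. psd_forcing_process G Z fs)"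

definition psd_forcing_number :: "('a,'b) pre_digraph \<Rightarrow> nat" ("Z\<^sub>+") where
  "Z\<^sub>+ G = (LEAST k. \<exists>Z. psd_forcing_set G Z \<and> card Z = k)"

definition forcing_tree ::
  "('a,'b) pre_digraph \<Rightarrow> ('a \<times> 'a) list \<Rightarrow> 'a \<Rightarrow> ('a,'b) pre_digraph" where
  "forcing_tree G fs r = G \<restriction> {v. (r, v) \<in> (set fs)\<^sup>*}"


section \<open>Tree covers\<close>

text \<open>
  In a symmetric digraph the two arcs of an edge form a directed cycle of length two, so the
  library's \<^const>\<open>tree\<close> does not describe undirected trees; the cycles of the undirected graph are
  the directed cycles of length at least three.
\<close>

definition undirected_tree :: "('a,'b) pre_digraph \<Rightarrow> bool" where
  "undirected_tree T \<longleftrightarrow>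
     Digraph_Component.connected T \<and> \<not> (\<exists>q. pre_digraph.cycle T q \<and> length q \<ge> 3)"

definition tree_cover :: "('a,'b) pre_digraph \<Rightarrow> ('a,'b) pre_digraph set \<Rightarrow> bool" where
  "tree_cover G \<T> \<longleftrightarrow>
     (\<forall>T\<in>\<T>. induced_subgraph T G \<and> undirected_tree T) \<and>
     pairwise (\<lambda>S T. verts S \<inter> verts T = {}) \<T> \<and>
     (\<Union>T\<in>\<T>. verts T) = verts G"

definition tree_cover_number :: "('a,'b) pre_digraph \<Rightarrow> nat" where
  "tree_cover_number G = (LEAST k. \<exists>\<T>. tree_cover G \<T> \<and> card \<T> = k)"

end

(* The combinatorial core is a statement about graphs of treewidth at most two: every partition into
   induced trees, minimal or not, arises from some choice of roots and some forcing process. Eliminate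
   a vertex v of degree at most two and join its neighbours. If v is a leaf of its tree, it is forced
   last; if v has both neighbours u, w in its tree, the reduced graph contains the tree edge uw and the
   force u -> w is subdivided into u -> v, v -> w; a singleton tree is deleted. The converse inequality
   holds in every graph, since a newly forced vertex is always a leaf of its forcing tree.

   An outerplanar graph can be eliminated in this way because its drawing survives the reduction and
   it has a vertex of degree at most two: minimum degree three yields a subdivision of K4 (consider a
   longest path), and four branch vertices of such a subdivision cannot all lie on the outer face. *)

theory Submission
  imports Defs
begin

section \<open>Forcing processes and elimination of vertices of degree at most two\<close>

text \<open>The roots are an output of the induction, not an input: which end of the new edge
  \<open>uw\<close> forces the other is known only after the reduced graph has been processed. A
  cover is therefore carried as a labelling \<open>t\<close> whose classes are the trees, and the
  induction returns the starting set together with the process.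

  The obstacle in putting \<open>v\<close> back is that it may join white components and so spoil
  the uniqueness condition of a force. The fill edge prevents this: it shortcuts every white path
  through \<open>v\<close>, so the reduced graph has already treated the joined components as one. A
  force along an old edge can then fail only if both its ends are neighbours of \<open>v\<close>. If
  the neighbours lie in different trees, no force runs between them, since forces preserve labels.
  If they share a tree other than that of \<open>v\<close>, then \<open>v\<close> is a singleton
  tree and starts black. If they lie in the tree of \<open>v\<close>, the force between them is the
  one to be subdivided, and after it both are black.\<close>

definition edges_on :: "('a \<Rightarrow> 'a \<Rightarrow> bool) \<Rightarrow> 'a set \<Rightarrow> ('a \<times> 'a) set" where
  "edges_on E S = {(x, y). x \<in> S \<and> y \<in> S \<and> E x y}"

text \<open>The white component of \<open>w\<close> appears as the set of white vertices reachable
  from \<open>w\<close>, so that no component has to be named; \<open>psd_forces_iff\<close>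
  identifies this with the given rule.\<close>

definition forces :: "('a \<Rightarrow> 'a \<Rightarrow> bool) \<Rightarrow> 'a set \<Rightarrow> 'a set \<Rightarrow> 'a \<Rightarrow> 'a \<Rightarrow> bool" where
  "forces E V B u w \<longleftrightarrow> u \<in> B \<and> w \<in> V - B \<and> E u w \<and>
     (\<forall>x. (w, x) \<in> (edges_on E (V - B))\<^sup>* \<and> E u x \<longrightarrow> x = w)"

fun process :: "('a \<Rightarrow> 'a \<Rightarrow> bool) \<Rightarrow> 'a set \<Rightarrow> 'a set \<Rightarrow> ('a \<times> 'a) list \<Rightarrow> bool" where
  "process E V B [] \<longleftrightarrow> B = V"
| "process E V B ((u, w) # fs) \<longleftrightarrow> forces E V B u w \<and> process E V (insert w B) fs"

definition mono_edges :: "('a \<Rightarrow> 'a \<Rightarrow> bool) \<Rightarrow> ('a \<Rightarrow> 'l) \<Rightarrow> 'a \<Rightarrow> 'a \<Rightarrow> bool" where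
  "mono_edges E t x y \<longleftrightarrow> E x y \<and> t x = t y"

text \<open>Forests are the graphs all of whose nonempty subgraphs have a vertex of degree at most one.\<close>

definition acyclic_on :: "('a \<Rightarrow> 'a \<Rightarrow> bool) \<Rightarrow> 'a set \<Rightarrow> bool" where
  "acyclic_on E V \<longleftrightarrow>
     (\<forall>S\<subseteq>V. S \<noteq> {} \<longrightarrow> (\<exists>x\<in>S. \<forall>y\<in>S. \<forall>z\<in>S. E x y \<and> E x z \<longrightarrow> y = z))"

definition tree_labelling :: "('a \<Rightarrow> 'a \<Rightarrow> bool) \<Rightarrow> 'a set \<Rightarrow> ('a \<Rightarrow> 'l) \<Rightarrow> bool" where
  "tree_labelling E V t \<longleftrightarrow> acyclic_on (mono_edges E t) V \<and>
     (\<forall>x\<in>V. \<forall>y\<in>V. t x = t y \<longrightarrow> (x, y) \<in> (edges_on (mono_edges E t) V)\<^sup>*)"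

text \<open>The fill-in of an elimination ordering; \<open>v\<close> itself is removed from the vertex set.\<close>

definition eliminate :: "'a \<Rightarrow> ('a \<Rightarrow> 'a \<Rightarrow> bool) \<Rightarrow> 'a \<Rightarrow> 'a \<Rightarrow> bool" where
  "eliminate v E x y \<longleftrightarrow> E x y \<or> E v x \<and> E v y \<and> x \<noteq> y"

definition deg_le2 :: "('a \<Rightarrow> 'a \<Rightarrow> bool) \<Rightarrow> 'a set \<Rightarrow> 'a \<Rightarrow> bool" where
  "deg_le2 E V v \<longleftrightarrow>
     (\<forall>x\<in>V. \<forall>y\<in>V. \<forall>z\<in>V. E v x \<and> E v y \<and> E v z \<longrightarrow> x = y \<or> y = z \<or> x = z)"

text \<open>Treewidth at most two. The premise on \<open>E\<close> itself is needed because the fill-in may close a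
  cycle in a tree of the cover when \<open>v\<close> is a tree of its own.\<close>

inductive tw2 :: "'a set \<Rightarrow> ('a \<Rightarrow> 'a \<Rightarrow> bool) \<Rightarrow> bool" where
  tw2_empty: "tw2 {} E"
| tw2_step: "\<lbrakk>v \<in> V; deg_le2 E V v; tw2 (V - {v}) E; tw2 (V - {v}) (eliminate v E)\<rbrakk> \<Longrightarrow> tw2 V E"

section \<open>Reachability and single forces under elimination of a vertex\<close>

lemma edges_on_rtrancl_mem: "(x, y) \<in> (edges_on E S)\<^sup>* \<Longrightarrow> x \<in> S \<Longrightarrow> y \<in> S"
  by (induction rule: rtrancl_induct) (auto simp: edges_on_def)

lemma edges_on_rtrancl_mono:
  assumes "(x, y) \<in> (edges_on E S)\<^sup>*" "S \<subseteq> S'" "\<And>a b. a \<in> S \<Longrightarrow> b \<in> S \<Longrightarrow> E a b \<Longrightarrow> E' a b"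
  shows "(x, y) \<in> (edges_on E' S')\<^sup>*"
  using assms(1)
proof (rule rtrancl_mono[THEN subsetD, rotated])
  show "edges_on E S \<subseteq> edges_on E' S'"
    using assms(2,3) by (auto simp: edges_on_def)
qed

lemma edges_on_rtrancl_sym:
  assumes "symp E" "(x, y) \<in> (edges_on E S)\<^sup>*"
  shows "(y, x) \<in> (edges_on E S)\<^sup>*"
proof -
  have "sym (edges_on E S)"
    using assms(1) by (auto simp: sym_def edges_on_def dest: sympD)
  then show ?thesis
    using assms(2) by (meson sym_rtrancl symD)
qed

text \<open>A passage through \<open>v\<close> is replaced by the fill edge between the vertices
  before and after it. The induction along the path also meets prefixes that end in
  \<open>v\<close>; for these only a neighbour \<open>n\<close> of \<open>v\<close> that has been
  reached is remembered.\<close>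

lemma eliminate_rtrancl:
  assumes "(b, y) \<in> (edges_on E S)\<^sup>*" "symp E" "b \<noteq> v" "b \<in> S"
  shows "if y = v then \<exists>n \<in> S - {v}. E v n \<and> (b, n) \<in> (edges_on (eliminate v E) (S - {v}))\<^sup>*
         else (b, y) \<in> (edges_on (eliminate v E) (S - {v}))\<^sup>*"
  using assms(1)
proof (induction rule: rtrancl_induct)
  case base
  then show ?case using assms(3) by simp
next
  case (step y z)
  let ?R = "edges_on (eliminate v E) (S - {v})"
  have yz: "y \<in> S" "z \<in> S" "E y z" using step.hyps by (auto simp: edges_on_def)
  have zy: "E z y" using yz(3) assms(2) by (blast dest: sympD)
  show ?case
  proof (cases "y = v")
    case True
    then obtain n where n: "n \<in> S - {v}" "E v n" "(b, n) \<in> ?R\<^sup>*"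
      using step.IH by auto
    show ?thesis
    proof (cases "z = v \<or> n = z")
      case True then show ?thesis using n by auto
    next
      case False
      then have "(n, z) \<in> ?R"
        using n yz \<open>y = v\<close> by (auto simp: edges_on_def eliminate_def)
      then show ?thesis using n False by (auto intro: rtrancl_into_rtrancl)
    qed
  next
    case False
    then have IH: "(b, y) \<in> ?R\<^sup>*" using step.IH by auto
    show ?thesis
    proof (cases "z = v")
      case True then show ?thesis using IH yz zy False by auto
    next
      case zv: False
      then have "(y, z) \<in> ?R"
        using yz False by (auto simp: edges_on_def eliminate_def)
      then show ?thesis using IH zv by (auto intro: rtrancl_into_rtrancl)
    qed
  qed
qed

text \<open>The only forces of the reduced graph that do not survive in \<open>E\<close> run between two neighbours of
  \<open>v\<close>.\<close>

lemma forces_eliminate: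
  assumes f: "forces (eliminate v E) (V - {v}) B a b" and E: "E a b" "\<not> (E v a \<and> E v b)"
    and "symp E" "v \<notin> B"
  shows "forces E V B a b"
  unfolding forces_def
proof (intro conjI allI impI)
  let ?R = "edges_on (eliminate v E) (V - {v} - B)"
  have ab: "a \<in> B" "b \<in> V - {v} - B"
    and uniq: "\<And>x. (b, x) \<in> ?R\<^sup>* \<Longrightarrow> eliminate v E a x \<Longrightarrow> x = b"
    using f by (auto simp: forces_def)
  show "a \<in> B" "b \<in> V - B" "E a b" using ab E by auto
  fix x assume x: "(b, x) \<in> (edges_on E (V - B))\<^sup>* \<and> E a x"
  have VB: "V - B - {v} = V - {v} - B" by blast
  have el: "if x = v then \<exists>n \<in> V - {v} - B. E v n \<and> (b, n) \<in> ?R\<^sup>* else (b, x) \<in> ?R\<^sup>*"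
    using eliminate_rtrancl[of b x E "V - B" v, unfolded VB] x ab \<open>symp E\<close> by blast
  show "x = b"
  proof (cases "x = v")
    case False
    then show ?thesis using el x uniq by (auto simp: eliminate_def)
  next
    case True
    then obtain n where n: "n \<in> V - {v} - B" "E v n" "(b, n) \<in> ?R\<^sup>*" using el by auto
    \<comment> \<open>Since \<open>v\<close> is adjacent to \<open>a\<close>, the fill joins
      \<open>a\<close> to the reachable neighbour \<open>n\<close> of \<open>v\<close>. Uniqueness
      makes \<open>n\<close> equal to \<open>b\<close>, and then \<open>a\<close> and
      \<open>b\<close> are both neighbours of \<open>v\<close>.\<close>
    have "E v a" using x True \<open>symp E\<close> by (auto dest: sympD)
    then have "eliminate v E a n" using n ab by (auto simp: eliminate_def)
    then have "n = b" using uniq n by blast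
    then show ?thesis using E n \<open>E v a\<close> by blast
  qed
qed

text \<open>Once all neighbours of \<open>v\<close> are black, an edge of \<open>E'\<close> outside
  \<open>E\<close> cannot end in a white vertex, so it carries no force. Blackening \<open>v\<close>
  leaves the same white vertices as deleting it, and passing to the fewer edges of \<open>E\<close>
  only weakens the uniqueness condition.\<close>

lemma forces_insert_finished:
  assumes f: "forces E' (V - {v}) B a b" and "\<And>x. x \<in> V \<Longrightarrow> E v x \<Longrightarrow> x \<in> B"
    and "symp E" "\<And>x y. E x y \<Longrightarrow> E' x y" "\<And>x y. E' x y \<Longrightarrow> E x y \<or> E v x \<and> E v y"
  shows "forces E V (insert v B) a b"
  unfolding forces_def
proof (intro conjI allI impI)
  have VB: "V - insert v B = V - {v} - B" by blast
  show "a \<in> insert v B" "b \<in> V - insert v B" using f by (auto simp: forces_def)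
  show "E a b" using f assms(2,5) unfolding forces_def by blast
  fix x assume x: "(b, x) \<in> (edges_on E (V - insert v B))\<^sup>* \<and> E a x"
  then have "(b, x) \<in> (edges_on E' (V - {v} - B))\<^sup>*"
    unfolding VB by (elim edges_on_rtrancl_mono[OF conjunct1]) (auto intro: assms(4))
  then show "x = b" using f x assms(4) unfolding forces_def by blast
qed

section \<open>Lifting a process of the reduced graph to the full graph\<close>

lemma process_subset: "process E V B fs \<Longrightarrow> B \<subseteq> V"
  by (induction fs arbitrary: B) (auto, blast)

lemma process_forces: "process E V B fs \<Longrightarrow> (a, b) \<in> set fs \<Longrightarrow> a \<in> V \<and> b \<in> V \<and> E a b"
proof (induction fs arbitrary: B)
  case (Cons f fs)
  have B: "B \<subseteq> V" using process_subset Cons.prems(1) .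
  obtain c d where "f = (c, d)" by fastforce
  then show ?case using Cons B by (auto simp: forces_def)
qed simp

text \<open>A vertex that is black from the start leaves the same white graph as its deletion. It
  may well have neighbours; they lie in other trees in the intended use, and \<open>v\<close> itself
  performs no force.\<close>

lemma process_add_isolated:
  assumes "process E (V - {v}) B fs" "v \<in> V"
  shows "process E V (insert v B) fs"
  using assms(1)
proof (induction fs arbitrary: B)
  case Nil
  then show ?case using assms(2) by auto
next
  case (Cons f fs)
  obtain c d where f: "f = (c, d)" by fastforce
  have "V - insert v B = V - {v} - B" by blast
  then have "forces E V (insert v B) c d" using Cons.prems f by (auto simp: forces_def)
  moreover have "process E V (insert v (insert d B)) fs"
    using Cons.IH[of "insert d B"] Cons.prems f by simp
  ultimately show ?case using f by (simp add: insert_commute[of d v])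
qed

lemma process_insert_finished:
  assumes "process E' (V - {v}) B fs" "v \<in> V" "\<And>x. x \<in> V \<Longrightarrow> E v x \<Longrightarrow> x \<in> B"
    and "symp E" "\<And>x y. E x y \<Longrightarrow> E' x y" "\<And>x y. E' x y \<Longrightarrow> E x y \<or> E v x \<and> E v y"
  shows "process E V (insert v B) fs"
  using assms(1,3)
proof (induction fs arbitrary: B)
  case Nil
  then show ?case using assms(2) by auto
next
  case (Cons f fs)
  obtain c d where f: "f = (c, d)" by fastforce
  have "forces E V (insert v B) c d"
    using Cons.prems f forces_insert_finished[of E' V v B c d E] assms(4-6) by auto
  moreover have "process E V (insert v (insert d B)) fs"
    using Cons.IH[of "insert d B"] Cons.prems f by auto
  ultimately show ?case using f by (simp add: insert_commute[of d v])
qed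

text \<open>When all other vertices are black, \<open>v\<close> is alone in its white component, so
  any neighbour can force it. The earlier forces survive with \<open>v\<close> white because none of
  them runs between two neighbours of \<open>v\<close>.\<close>

lemma process_add_leaf:
  assumes "process (eliminate v E) (V - {v}) B fs" "v \<in> V" "v \<notin> B" "u \<in> V" "u \<noteq> v" "E u v"
    and "symp E" and fs: "\<forall>(a, b) \<in> set fs. E a b \<and> \<not> (E v a \<and> E v b)"
  shows "process E V B (fs @ [(u, v)])"
  using assms(1,3) fs
proof (induction fs arbitrary: B)
  case Nil
  have "B = V - {v}" using Nil by simp
  then have VB: "V - B = {v}" using assms(2) by auto
  have "(v, x) \<in> (edges_on E {v})\<^sup>* \<Longrightarrow> x = v" for x
    using edges_on_rtrancl_mem[of v x E "{v}"] by simp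
  then have "forces E V B u v" unfolding forces_def VB using assms Nil by auto
  then show ?case using \<open>B = V - {v}\<close> assms(2) by auto
next
  case (Cons f fs)
  obtain c d where f: "f = (c, d)" by fastforce
  have fc: "forces (eliminate v E) (V - {v}) B c d" using Cons.prems f by simp
  then have "forces E V B c d"
    using forces_eliminate[of v E V B c d] Cons.prems f \<open>symp E\<close> by auto
  moreover have "d \<noteq> v" using fc by (auto simp: forces_def)
  ultimately show ?case using Cons f by auto
qed

text \<open>Before the force along the fill edge every force survives with \<open>v\<close> white;
  after it both neighbours of \<open>v\<close> are black and \<open>process_insert_finished\<close>
  takes over. The direction of that force is not known in advance, so its ends \<open>a\<close>,
  \<open>b\<close> are part of the conclusion.\<close>

lemma process_subdivide:
  assumes "process (eliminate v E) (V - {v}) B fs" "v \<in> V" "v \<notin> B"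
    and "symp E" and nb: "{x \<in> V. E v x} = {u, w}" and "\<not> E u w" "\<not> E v v"
    and fs: "\<forall>(a, b) \<in> set fs. E a b \<or> E v a \<and> E v b"
    and "(u, w) \<in> set fs \<or> (w, u) \<in> set fs"
  shows "\<exists>gs a b. process E V B gs \<and> {a, b} = {u, w} \<and> set fs \<subseteq> insert (a, b) (set gs) \<and>
    set gs \<subseteq> set fs \<union> {(a, v), (v, b)} \<and> (a, v) \<in> set gs \<and> (v, b) \<in> set gs"
  using assms(1,3) fs assms(9)
proof (induction fs arbitrary: B)
  case Nil
  then show ?case by simp
next
  case (Cons f fs)
  obtain a b where f: "f = (a, b)" by fastforce
  have fab: "forces (eliminate v E) (V - {v}) B a b" using Cons.prems f by simp
  then have ab: "a \<in> B" "b \<in> V - {v} - B" "eliminate v E a b"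
    and uniq: "\<And>x. (b, x) \<in> (edges_on (eliminate v E) (V - {v} - B))\<^sup>* \<Longrightarrow>
                eliminate v E a x \<Longrightarrow> x = b"
    by (auto simp: forces_def)
  have aV: "a \<in> V" using process_subset[OF Cons.prems(1)] ab by auto
  have nuw: "\<not> E u w" "\<not> E w u" using \<open>\<not> E u w\<close> \<open>symp E\<close> by (auto dest: sympD)
  show ?case
  proof (cases "E v a \<and> E v b")
    case False
    then have Eab: "E a b" using Cons.prems(3) f by auto
    have fE: "forces E V B a b"
      using forces_eliminate[OF fab Eab False \<open>symp E\<close>] Cons.prems by simp
    have "(u, w) \<in> set fs \<or> (w, u) \<in> set fs"
      using Cons.prems(4) f Eab nuw by auto
    moreover have "process (eliminate v E) (V - {v}) (insert b B) fs" "v \<notin> insert b B"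
      "\<forall>(a, b) \<in> set fs. E a b \<or> E v a \<and> E v b"
      using Cons.prems(1-3) f ab(2) by auto
    ultimately obtain gs c d where gs: "process E V (insert b B) gs" "{c, d} = {u, w}"
      "set fs \<subseteq> insert (c, d) (set gs)"
      "set gs \<subseteq> set fs \<union> {(c, v), (v, d)}" "(c, v) \<in> set gs" "(v, d) \<in> set gs"
      using Cons.IH[of "insert b B"] by blast
    have "process E V B ((a, b) # gs)" using fE gs(1) by simp
    moreover have "set (f # fs) \<subseteq> insert (c, d) (set ((a, b) # gs))" using f gs(3) by auto
    moreover have "set ((a, b) # gs) \<subseteq> set (f # fs) \<union> {(c, v), (v, d)}" using f gs(4) by auto
    moreover have "(c, v) \<in> set ((a, b) # gs)" "(v, d) \<in> set ((a, b) # gs)"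
      using gs(5,6) by simp_all
    ultimately show ?thesis using gs(2) by (intro exI conjI)
  next
    case True
    have "a \<in> {u, w}" "b \<in> {u, w}" using True ab aV nb by auto
    moreover have "a \<noteq> b" using ab by auto
    ultimately have uw: "{a, b} = {u, w}" and nab: "\<not> E a b" using nuw by auto
    have nbv: "E v x \<Longrightarrow> x \<in> V \<Longrightarrow> x = a \<or> x = b" for x using nb uw by blast
    \<comment> \<open>The white component of \<open>v\<close> contains \<open>b\<close>. Another
      neighbour \<open>x\<close> of \<open>a\<close> in it would already be reachable from
      \<open>b\<close> in the reduced graph, so \<open>x = b\<close>; but \<open>a\<close> and
      \<open>b\<close> are not adjacent in \<open>E\<close>.\<close>
    have "forces E V B a v"
      unfolding forces_def
    proof (intro conjI allI impI)
      show "a \<in> B" "v \<in> V - B" "E a v"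
        using ab Cons.prems assms(2) True \<open>symp E\<close> by (auto dest: sympD)
      fix x assume x: "(v, x) \<in> (edges_on E (V - B))\<^sup>* \<and> E a x"
      show "x = v"
      proof (rule ccontr)
        assume "x \<noteq> v"
        have "(b, v) \<in> edges_on E (V - B)"
          using ab True assms(2) Cons.prems(2) \<open>symp E\<close> by (auto simp: edges_on_def dest: sympD)
        then have "(b, x) \<in> (edges_on E (V - B))\<^sup>*"
          using x by (meson converse_rtrancl_into_rtrancl)
        moreover have "V - B - {v} = V - {v} - B" by blast
        ultimately have "(b, x) \<in> (edges_on (eliminate v E) (V - {v} - B))\<^sup>*"
          using eliminate_rtrancl[of b x E "V - B" v] ab \<open>x \<noteq> v\<close> \<open>symp E\<close> by auto
        then have "x = b" using uniq x by (auto simp: eliminate_def)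
        then show False using x nab by simp
      qed
    qed
    moreover have "forces E V (insert v B) v b"
      unfolding forces_def
    proof (intro conjI allI impI)
      show "v \<in> insert v B" "b \<in> V - insert v B" "E v b" using ab True by auto
      fix x assume x: "(b, x) \<in> (edges_on E (V - insert v B))\<^sup>* \<and> E v x"
      have "x \<in> V - insert v B"
        using edges_on_rtrancl_mem[of b x E "V - insert v B"] x ab by blast
      then show "x = b" using nbv[of x] x ab by blast
    qed
    moreover have "process E V (insert v (insert b B)) fs"
    proof (rule process_insert_finished)
      show "process (eliminate v E) (V - {v}) (insert b B) fs" using Cons.prems(1) f by simp
      show "x \<in> insert b B" if "x \<in> V" "E v x" for x using nbv that ab(1) by blast
    qed (use assms(2,4) in \<open>auto simp: eliminate_def\<close>)
    ultimately have "process E V B ((a, v) # (v, b) # fs)"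
      by (simp add: insert_commute[of b v])
    moreover have "set (f # fs) \<subseteq> insert (a, b) (set ((a, v) # (v, b) # fs))"
      "set ((a, v) # (v, b) # fs) \<subseteq> set (f # fs) \<union> {(a, v), (v, b)}"
      "(a, v) \<in> set ((a, v) # (v, b) # fs)" "(v, b) \<in> set ((a, v) # (v, b) # fs)"
      using f by auto
    ultimately show ?thesis using uw by (intro exI conjI)
  qed
qed

section \<open>Tree labellings under elimination\<close>

lemma acyclic_on_subset:
  assumes "acyclic_on E V" "V' \<subseteq> V" "\<And>x y. x \<in> V' \<Longrightarrow> y \<in> V' \<Longrightarrow> E' x y \<Longrightarrow> E x y"
  shows "acyclic_on E' V'"
  unfolding acyclic_on_def
proof (intro allI impI)
  fix S assume "S \<subseteq> V'" "S \<noteq> {}"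
  moreover from this obtain x where "x \<in> S" "\<forall>y\<in>S. \<forall>z\<in>S. E x y \<and> E x z \<longrightarrow> y = z"
    using assms(1,2) unfolding acyclic_on_def by (meson order_trans)
  ultimately show "\<exists>x\<in>S. \<forall>y\<in>S. \<forall>z\<in>S. E' x y \<and> E' x z \<longrightarrow> y = z"
    using assms(3) by (meson subsetD)
qed

lemma symp_mono_edges: "symp E \<Longrightarrow> symp (mono_edges E t)"
  unfolding symp_def mono_edges_def by metis

lemma symp_eliminate: "symp E \<Longrightarrow> symp (eliminate v E)"
  unfolding symp_def eliminate_def by metis

text \<open>A set \<open>S\<close> containing both \<open>u\<close> and \<open>w\<close> is tested
  on \<open>insert v S\<close> in the old graph. The vertex of degree at most one found there is not
  \<open>v\<close>. If it is \<open>u\<close> or \<open>w\<close>, its only old neighbour in that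
  set is \<open>v\<close>, and the new edge \<open>uw\<close> takes the place of the edge to
  \<open>v\<close>.\<close>

lemma acyclic_on_smooth:
  assumes ac: "acyclic_on M V" and "symp M" "v \<in> V" and uw: "{x \<in> V. M v x} = {u, w}" "u \<noteq> w"
    and M': "\<And>x y. x \<in> V - {v} \<Longrightarrow> y \<in> V - {v} \<Longrightarrow> M' x y \<Longrightarrow> M x y \<or> {x, y} = {u, w}"
  shows "acyclic_on M' (V - {v})"
  unfolding acyclic_on_def
proof (intro allI impI)
  fix S assume S: "S \<subseteq> V - {v}" "S \<noteq> {}"
  have vuw: "M v u" "M v w" "M u v" "M w v"
    using uw \<open>symp M\<close> by (blast dest: sympD)+
  show "\<exists>x\<in>S. \<forall>y\<in>S. \<forall>z\<in>S. M' x y \<and> M' x z \<longrightarrow> y = z"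
  proof (cases "u \<in> S \<and> w \<in> S")
    case False
    then have "M' x y \<Longrightarrow> M x y" if "x \<in> S" "y \<in> S" for x y
      using M'[of x y] S that by (auto simp: doubleton_eq_iff)
    moreover obtain x where "x \<in> S" "\<forall>y\<in>S. \<forall>z\<in>S. M x y \<and> M x z \<longrightarrow> y = z"
      using ac S unfolding acyclic_on_def by (meson Diff_subset order_trans)
    ultimately show ?thesis by blast
  next
    case True
    have "insert v S \<subseteq> V" using S \<open>v \<in> V\<close> by auto
    then obtain x where x: "x \<in> insert v S"
      "\<forall>y\<in>insert v S. \<forall>z\<in>insert v S. M x y \<and> M x z \<longrightarrow> y = z"
      using ac unfolding acyclic_on_def by (metis insert_not_empty)
    have "x \<noteq> v" using x(2) True vuw uw(2) by blast
    then have xS: "x \<in> S" using x(1) by simp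
    have "y = z" if yz: "y \<in> S" "z \<in> S" "M' x y" "M' x z" for y z
    proof (cases "x = u \<or> x = w")
      case True
      then have "\<not> M x y" "\<not> M x z" using x(2) vuw yz S by blast+
      then have "{x, y} = {u, w}" "{x, z} = {u, w}" using M'[of x y] M'[of x z] yz xS S by blast+
      then show ?thesis by (auto simp: doubleton_eq_iff)
    next
      case False
      then have "M x y" "M x z"
        using M'[of x y] M'[of x z] yz xS S by (auto simp: doubleton_eq_iff)
      then show ?thesis using x(2) yz by blast
    qed
    then show ?thesis using xS by blast
  qed
qed

text \<open>The shortcut is made inside the monochromatic graph: its fill edges join two neighbours
  of \<open>v\<close> that both have the label of \<open>v\<close>, hence they are fill edges of
  \<open>E\<close> within one class.\<close>

lemma connected_labels_eliminate:
  assumes "\<forall>x\<in>V. \<forall>y\<in>V. t x = t y \<longrightarrow> (x, y) \<in> (edges_on (mono_edges E t) V)\<^sup>*" "symp E"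
  shows "\<forall>x\<in>V - {v}. \<forall>y\<in>V - {v}.
    t x = t y \<longrightarrow> (x, y) \<in> (edges_on (mono_edges (eliminate v E) t) (V - {v}))\<^sup>*"
proof (intro ballI impI)
  fix x y assume xy: "x \<in> V - {v}" "y \<in> V - {v}" "t x = t y"
  let ?M = "mono_edges E t"
  have "(x, y) \<in> (edges_on ?M V)\<^sup>*" using assms(1) xy by auto
  then have "(x, y) \<in> (edges_on (eliminate v ?M) (V - {v}))\<^sup>*"
    using eliminate_rtrancl[of x y ?M V v] xy symp_mono_edges[OF \<open>symp E\<close>] by auto
  then show "(x, y) \<in> (edges_on (mono_edges (eliminate v E) t) (V - {v}))\<^sup>*"
    by (rule edges_on_rtrancl_mono) (auto simp: eliminate_def mono_edges_def)
qed

text \<open>\<open>Z\<close> has one vertex for each label. The last clause, that every edge inside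
  a class is used by a force, strengthens the induction: it guarantees that a fill edge inside a
  tree carries a force to subdivide.\<close>

definition realizes :: "('a \<Rightarrow> 'a \<Rightarrow> bool) \<Rightarrow> 'a set \<Rightarrow> ('a \<Rightarrow> 'l) \<Rightarrow> 'a set \<Rightarrow> ('a \<times> 'a) list \<Rightarrow> bool" where
  "realizes E V t Z fs \<longleftrightarrow> process E V Z fs \<and> inj_on t Z \<and> t ` Z = t ` V \<and>
     (\<forall>(a, b)\<in>set fs. t a = t b) \<and>
     (\<forall>x\<in>V. \<forall>y\<in>V. mono_edges E t x y \<longrightarrow> (x, y) \<in> set fs \<or> (y, x) \<in> set fs)"

lemma realizes_isolated:
  assumes lab: "tree_labelling E V t" and "v \<in> V" "symp E"
    and iso: "\<And>x. x \<in> V \<Longrightarrow> \<not> mono_edges E t v x"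
  shows "tree_labelling E (V - {v}) t"
    and "realizes E (V - {v}) t Z fs \<Longrightarrow> realizes E V t (insert v Z) fs"
proof -
  let ?M = "mono_edges E t"
  have symM: "symp ?M" using symp_mono_edges[OF \<open>symp E\<close>] .
  have iso': "x \<in> V \<Longrightarrow> \<not> ?M x v" for x using iso[of x] sympD[OF symM, of x v] by blast
  have eq: "edges_on ?M V = edges_on ?M (V - {v})"
    using iso iso' by (auto simp: edges_on_def)
  show "tree_labelling E (V - {v}) t"
    using lab acyclic_on_subset[of ?M V "V - {v}" ?M] unfolding tree_labelling_def eq by auto
  \<comment> \<open>No edge of the class of \<open>v\<close> meets \<open>v\<close>, while classes
    are connected; so this class is the singleton of \<open>v\<close> and its label is
    fresh.\<close>
  have new: "t v \<notin> t ` (V - {v})"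
  proof
    assume "t v \<in> t ` (V - {v})"
    then obtain x where x: "x \<in> V - {v}" "t x = t v" by (metis imageE)
    then have "(x, v) \<in> (edges_on ?M (V - {v}))\<^sup>*"
      using lab \<open>v \<in> V\<close> unfolding tree_labelling_def eq by auto
    then show False using edges_on_rtrancl_mem x by fastforce
  qed
  show "realizes E V t (insert v Z) fs" if r: "realizes E (V - {v}) t Z fs"
  proof -
    have pr: "process E (V - {v}) Z fs" and Z: "inj_on t Z" "t ` Z = t ` (V - {v})"
      and mono: "\<forall>(a, b)\<in>set fs. t a = t b"
      and cov: "\<And>x y. x \<in> V - {v} \<Longrightarrow> y \<in> V - {v} \<Longrightarrow> ?M x y \<Longrightarrow> (x, y) \<in> set fs \<or> (y, x) \<in> set fs"
      using r unfolding realizes_def by blast+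
    have "t v \<notin> t ` (Z - {v})" using Z(2) new by blast
    then have "inj_on t (insert v Z)" using Z(1) by (simp add: inj_on_insert)
    moreover have "t ` insert v Z = t ` V"
      unfolding image_insert Z(2) using \<open>v \<in> V\<close> by blast
    moreover have "(x, y) \<in> set fs \<or> (y, x) \<in> set fs" if "x \<in> V" "y \<in> V" "?M x y" for x y
      using iso[of y] iso'[of x] that cov[of x y] by blast
    ultimately show ?thesis
      using process_add_isolated[OF pr \<open>v \<in> V\<close>] mono unfolding realizes_def by simp
  qed
qed

lemma realizes_leaf:
  assumes lab: "tree_labelling E V t" and "v \<in> V" "symp E" "\<And>x. \<not> E x x" and deg: "deg_le2 E V v"
    and nb: "{x \<in> V. mono_edges E t v x} = {u}"
  shows "tree_labelling (eliminate v E) (V - {v}) t"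
    and "realizes (eliminate v E) (V - {v}) t Z fs \<Longrightarrow> \<exists>gs. realizes E V t Z gs"
proof -
  let ?M = "mono_edges E t" and ?M' = "mono_edges (eliminate v E) t"
  have "u \<in> V" "?M v u" using nb by auto
  then have u: "u \<in> V" "E v u" "t u = t v" "E u v" "u \<noteq> v"
    using assms(3,4) by (auto simp: mono_edges_def dest: sympD)
  \<comment> \<open>Only \<open>u\<close> shares the label of \<open>v\<close>, so a second
    neighbour of \<open>v\<close> is labelled differently from \<open>u\<close>. The fill edge thus
    lies in no class, and no label-preserving force can use it.\<close>
  have fill: "\<not> (E v x \<and> E v y \<and> x \<noteq> y \<and> t x = t y)" if "x \<in> V" "y \<in> V" for x y
  proof
    assume xy: "E v x \<and> E v y \<and> x \<noteq> y \<and> t x = t y"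
    then have "x = u \<or> y = u" using deg u that unfolding deg_le2_def by blast
    then have "?M v x" "?M v y" using xy u by (auto simp: mono_edges_def)
    then have "x \<in> {u}" "y \<in> {u}" using nb that by auto
    then show False using xy by simp
  qed
  have M': "?M x y" if "x \<in> V - {v}" "y \<in> V - {v}" "?M' x y" for x y
    using that fill[of x y] by (auto simp: mono_edges_def eliminate_def)
  show "tree_labelling (eliminate v E) (V - {v}) t"
    using lab acyclic_on_subset[of ?M V "V - {v}" ?M'] M'
      connected_labels_eliminate[of V t E v] \<open>symp E\<close> unfolding tree_labelling_def by auto
  show "\<exists>gs. realizes E V t Z gs" if r: "realizes (eliminate v E) (V - {v}) t Z fs"
  proof
    have pr: "process (eliminate v E) (V - {v}) Z fs" and mono: "\<forall>(a, b)\<in>set fs. t a = t b"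
      and cov: "\<And>x y. x \<in> V - {v} \<Longrightarrow> y \<in> V - {v} \<Longrightarrow> ?M' x y \<Longrightarrow> (x, y) \<in> set fs \<or> (y, x) \<in> set fs"
      using r unfolding realizes_def by blast+
    have "E a b \<and> \<not> (E v a \<and> E v b)" if "(a, b) \<in> set fs" for a b
    proof -
      have ab: "a \<in> V - {v}" "b \<in> V - {v}" "eliminate v E a b" "t a = t b"
        using process_forces[OF pr that] mono that by auto
      then have "a \<noteq> b" using assms(4) by (auto simp: eliminate_def)
      then show ?thesis using ab fill[of a b] by (auto simp: eliminate_def)
    qed
    then have "process E V Z (fs @ [(u, v)])"
      using process_add_leaf[OF pr \<open>v \<in> V\<close>, of u] process_subset[OF pr] u \<open>symp E\<close> by blast
    moreover have "t ` Z = t ` V"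
    proof -
      have "t v \<in> t ` (V - {v})" using u by (metis Diff_iff image_eqI singletonD)
      then have "t ` (V - {v}) = t ` V" using \<open>v \<in> V\<close> by auto
      then show ?thesis using r unfolding realizes_def by simp
    qed
    moreover have "\<forall>(a, b)\<in>set (fs @ [(u, v)]). t a = t b" using mono u(3) by auto
    moreover have "(x, y) \<in> set (fs @ [(u, v)]) \<or> (y, x) \<in> set (fs @ [(u, v)])"
      if xy: "x \<in> V" "y \<in> V" "?M x y" for x y
    proof (cases "x = v \<or> y = v")
      case True
      moreover have "x = v \<Longrightarrow> y \<in> {u}" "y = v \<Longrightarrow> x \<in> {u}"
        unfolding nb[symmetric] using xy sympD[OF symp_mono_edges[OF \<open>symp E\<close>, of t] xy(3)] by auto
      ultimately show ?thesis by auto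
    next
      case False
      then show ?thesis using cov[of x y] xy by (auto simp: mono_edges_def eliminate_def)
    qed
    ultimately show "realizes E V t Z (fs @ [(u, v)])"
      using r unfolding realizes_def by blast
  qed
qed

lemma realizes_smooth:
  assumes lab: "tree_labelling E V t" and "v \<in> V" "symp E" "\<And>x. \<not> E x x" and deg: "deg_le2 E V v"
    and nb: "u \<in> V" "w \<in> V" "u \<noteq> w" "mono_edges E t v u" "mono_edges E t v w"
  shows "tree_labelling (eliminate v E) (V - {v}) t"
    and "realizes (eliminate v E) (V - {v}) t Z fs \<Longrightarrow> \<exists>gs. realizes E V t Z gs"
proof -
  let ?M = "mono_edges E t" and ?M' = "mono_edges (eliminate v E) t"
  have uw: "E v u" "E v w" "t u = t v" "t w = t v" "E u v" "E w v" "u \<noteq> v" "w \<noteq> v"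
    using nb assms(3,4) by (auto simp: mono_edges_def dest: sympD)
  have nbE: "{x \<in> V. E v x} = {u, w}"
    using deg uw nb unfolding deg_le2_def by blast
  then have nbM: "{x \<in> V. ?M v x} = {u, w}"
    using uw by (auto simp: mono_edges_def)
  have symM: "symp ?M" using symp_mono_edges \<open>symp E\<close> by blast
  have M': "?M x y \<or> {x, y} = {u, w}" if "x \<in> V - {v}" "y \<in> V - {v}" "?M' x y" for x y
  proof (cases "E x y")
    case False
    then have "E v x" "E v y" "x \<noteq> y" using that by (auto simp: mono_edges_def eliminate_def)
    then have "x \<in> {u, w}" "y \<in> {u, w}" using nbE that(1,2) by auto
    then show ?thesis using \<open>x \<noteq> y\<close> by auto
  qed (use that in \<open>auto simp: mono_edges_def\<close>)
  have ac: "acyclic_on ?M V" using lab unfolding tree_labelling_def by blast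
  \<comment> \<open>An edge \<open>uw\<close> would close a triangle inside one class. Hence
    \<open>uw\<close> is a genuinely new edge, and a force along it cannot be kept
    unchanged.\<close>
  have nuw: "\<not> E u w"
  proof
    assume "E u w"
    then have M: "?M u w" "?M w u" "?M u v" "?M v u" "?M v w" "?M w v"
      using uw \<open>symp E\<close> by (auto simp: mono_edges_def dest: sympD)
    have "{u, v, w} \<subseteq> V" using nb \<open>v \<in> V\<close> by auto
    then obtain x where x: "x \<in> {u, v, w}"
      "\<forall>y\<in>{u, v, w}. \<forall>z\<in>{u, v, w}. ?M x y \<and> ?M x z \<longrightarrow> y = z"
      using ac unfolding acyclic_on_def by (metis insert_not_empty)
    from x(1) have "x = u \<or> x = v \<or> x = w" by simp
    moreover have "x = u \<Longrightarrow> v = w" "x = v \<Longrightarrow> u = w" "x = w \<Longrightarrow> v = u"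
      using x(2) M by blast+
    ultimately show False using uw(7,8) nb(3) by blast
  qed
  show "tree_labelling (eliminate v E) (V - {v}) t"
    using acyclic_on_smooth[OF ac symM \<open>v \<in> V\<close> nbM nb(3) M'] lab
      connected_labels_eliminate[of V t E v] \<open>symp E\<close> unfolding tree_labelling_def by auto
  show "\<exists>gs. realizes E V t Z gs" if r: "realizes (eliminate v E) (V - {v}) t Z fs"
  proof -
    have pr: "process (eliminate v E) (V - {v}) Z fs" and mono: "\<forall>(a, b)\<in>set fs. t a = t b"
      and cov: "\<And>x y. x \<in> V - {v} \<Longrightarrow> y \<in> V - {v} \<Longrightarrow> ?M' x y \<Longrightarrow> (x, y) \<in> set fs \<or> (y, x) \<in> set fs"
      using r unfolding realizes_def by blast+
    have vZ: "v \<notin> Z" using process_subset[OF pr] by blast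
    have fE: "\<forall>(a, b)\<in>set fs. E a b \<or> E v a \<and> E v b"
      using process_forces[OF pr] by (auto simp: eliminate_def)
    have "?M' u w" using nb uw by (simp add: mono_edges_def eliminate_def)
    then have "(u, w) \<in> set fs \<or> (w, u) \<in> set fs" using cov[of u w] nb uw by simp
    then obtain gs a b where gs: "process E V Z gs" and ab: "{a, b} = {u, w}"
      and sub: "set fs \<subseteq> insert (a, b) (set gs)" "set gs \<subseteq> set fs \<union> {(a, v), (v, b)}"
      and new: "(a, v) \<in> set gs" "(v, b) \<in> set gs"
      using process_subdivide[OF pr \<open>v \<in> V\<close> vZ \<open>symp E\<close> nbE nuw assms(4) fE] by blast
    have nab: "\<not> E a b" "t a = t v" "t b = t v"
      using ab nuw sympD[OF \<open>symp E\<close>, of w u] uw by (auto simp: doubleton_eq_iff)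
    have "t ` Z = t ` V"
    proof -
      have "t v \<in> t ` (V - {v})" using uw nb by (metis Diff_iff image_eqI singletonD)
      then have "t ` (V - {v}) = t ` V" using \<open>v \<in> V\<close> by auto
      then show ?thesis using r unfolding realizes_def by simp
    qed
    moreover have "(x, y) \<in> set gs \<or> (y, x) \<in> set gs" if xy: "x \<in> V" "y \<in> V" "?M x y" for x y
    proof (cases "x = v \<or> y = v")
      case True
      have "x = v \<Longrightarrow> y \<in> {a, b}" "y = v \<Longrightarrow> x \<in> {a, b}"
        unfolding ab nbM[symmetric] using xy sympD[OF symM xy(3)] by auto
      then show ?thesis using True new by auto
    next
      case False
      then have "(x, y) \<in> set fs \<or> (y, x) \<in> set fs"
        using cov[of x y] xy by (auto simp: mono_edges_def eliminate_def)
      \<comment> \<open>The pair \<open>(a, b)\<close> is the only force of \<open>fs\<close> that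
        may be missing from \<open>gs\<close>, and it is not an edge of \<open>E\<close>.\<close>
      moreover have "(x, y) \<noteq> (a, b)" "(y, x) \<noteq> (a, b)"
        using nab xy sympD[OF \<open>symp E\<close>, of x y] by (auto simp: mono_edges_def)
      ultimately show ?thesis using sub(1) by blast
    qed
    moreover have "\<forall>(c, d)\<in>set gs. t c = t d" using sub(2) mono nab by auto
    ultimately have "realizes E V t Z gs" using r gs unfolding realizes_def by blast
    then show ?thesis by blast
  qed
qed

theorem tw2_realizes:
  assumes "tw2 V E" "symp E" "\<And>x. \<not> E x x" "tree_labelling E V t"
  shows "\<exists>Z fs. realizes E V t Z fs"
  using assms
proof (induction rule: tw2.induct)
  case (tw2_empty E)
  have "realizes E {} t {} []" by (simp add: realizes_def)
  then show ?case by blast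
next
  case (tw2_step v V E)
  have sym': "symp (eliminate v E)" and irr': "\<And>x. \<not> eliminate v E x x"
    using symp_eliminate[OF tw2_step.prems(1)] tw2_step.prems(2) by (auto simp: eliminate_def)
  consider "\<And>x. x \<in> V \<Longrightarrow> \<not> mono_edges E t v x"
    | u where "{x \<in> V. mono_edges E t v x} = {u}"
    | u w where "u \<in> V" "w \<in> V" "u \<noteq> w" "mono_edges E t v u" "mono_edges E t v w"
    by blast
  then show ?case
  proof cases
    case 1
    note R = realizes_isolated[OF tw2_step.prems(3) tw2_step.hyps(1) tw2_step.prems(1) 1]
    show ?thesis using R(2) tw2_step.IH(1)[OF tw2_step.prems(1,2) R(1)] by blast
  next
    case 2
    note R = realizes_leaf[OF tw2_step.prems(3) tw2_step.hyps(1) tw2_step.prems(1,2) tw2_step.hyps(2) 2]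
    show ?thesis using R(2) tw2_step.IH(2)[OF sym' irr' R(1)] by blast
  next
    case 3
    note R = realizes_smooth[OF tw2_step.prems(3) tw2_step.hyps(1) tw2_step.prems(1,2) tw2_step.hyps(2) 3]
    show ?thesis using R(2) tw2_step.IH(2)[OF sym' irr' R(1)] by blast
  qed
qed

section \<open>From forcing processes to tree covers\<close>

lemma tree_labelling_id:
  assumes "\<And>x. \<not> E x x"
  shows "tree_labelling E V id"
proof -
  have "\<not> mono_edges E id x y" for x y using assms by (auto simp: mono_edges_def)
  then show ?thesis by (auto simp: tree_labelling_def acyclic_on_def)
qed

text \<open>A set containing \<open>w\<close> has \<open>w\<close> itself as a vertex of degree at
  most one, and a set without \<open>w\<close> is an old one. Connectedness of the enlarged class
  goes through the edge \<open>uw\<close>.\<close>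

lemma tree_labelling_insert_leaf:
  assumes lab: "tree_labelling E B t" and "symp E" "\<And>x. \<not> E x x" and "u \<in> B" "w \<notin> B" "E u w"
    and leaf: "\<And>y. y \<in> B \<Longrightarrow> E y w \<Longrightarrow> t y = t u \<Longrightarrow> y = u"
  shows "tree_labelling E (insert w B) (t(w := t u))"
  unfolding tree_labelling_def
proof
  let ?t = "t(w := t u)"
  let ?M = "mono_edges E t" and ?M1 = "mono_edges E ?t"
  have same: "?M1 x y = ?M x y" if "x \<in> B" "y \<in> B" for x y
    using that \<open>w \<notin> B\<close> by (auto simp: mono_edges_def)
  have acB: "acyclic_on ?M B" using lab unfolding tree_labelling_def by simp
  show "acyclic_on ?M1 (insert w B)"
    unfolding acyclic_on_def
  proof (intro allI impI)
    fix S assume S: "S \<subseteq> insert w B" "S \<noteq> {}"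
    show "\<exists>x\<in>S. \<forall>y\<in>S. \<forall>z\<in>S. ?M1 x y \<and> ?M1 x z \<longrightarrow> y = z"
    proof (cases "w \<in> S")
      case True
      have "y = u" if "y \<in> S" "?M1 w y" for y
      proof -
        have "y \<noteq> w" using that assms(3) by (auto simp: mono_edges_def)
        then have "y \<in> B" "t y = t u" "E w y" using that S by (auto simp: mono_edges_def)
        then show ?thesis using leaf[of y] sympD[OF \<open>symp E\<close>, of w y] by blast
      qed
      then show ?thesis using True by blast
    next
      case False
      then have "S \<subseteq> B" using S by blast
      then obtain x where "x \<in> S" "\<forall>y\<in>S. \<forall>z\<in>S. ?M x y \<and> ?M x z \<longrightarrow> y = z"
        using acB S(2) unfolding acyclic_on_def by meson
      moreover have "?M1 x y = ?M x y" if "y \<in> S" for y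
        using same[of x y] that \<open>x \<in> S\<close> \<open>S \<subseteq> B\<close> by blast
      ultimately show ?thesis by blast
    qed
  qed
  let ?R1 = "(edges_on ?M1 (insert w B))\<^sup>*"
  have old: "(x, y) \<in> ?R1" if "x \<in> B" "y \<in> B" "t x = t y" for x y
  proof (rule edges_on_rtrancl_mono)
    show "(x, y) \<in> (edges_on ?M B)\<^sup>*" using lab that unfolding tree_labelling_def by blast
  qed (use same in blast)+
  have "(u, w) \<in> edges_on ?M1 (insert w B)"
    using assms(4-6) by (auto simp: edges_on_def mono_edges_def)
  then have new: "(x, w) \<in> ?R1" if "x \<in> B" "t x = t u" for x
    using old[of x u] that \<open>u \<in> B\<close> by (meson rtrancl.rtrancl_into_rtrancl)
  have new': "(w, x) \<in> ?R1" if "x \<in> B" "t x = t u" for x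
    using edges_on_rtrancl_sym[OF symp_mono_edges[OF \<open>symp E\<close>] new[OF that]] .
  show "\<forall>x\<in>insert w B. \<forall>y\<in>insert w B. ?t x = ?t y \<longrightarrow> (x, y) \<in> ?R1"
    using old new new' by auto
qed

text \<open>Invariant of the forcing process: no class of \<open>t\<close> has two members adjacent to the same white
  component. Hence every forced vertex is a leaf of its class.\<close>

lemma process_tree_labelling_aux:
  assumes "process E V B fs" "symp E" "\<And>x. \<not> E x x" "tree_labelling E B t"
    and "\<And>u u' x x'. \<lbrakk>u \<in> B; u' \<in> B; t u = t u'; x \<in> V - B; E u x; E u' x';
      (x, x') \<in> (edges_on E (V - B))\<^sup>*\<rbrakk> \<Longrightarrow> u = u'"
  shows "\<exists>t'. tree_labelling E V t' \<and> t' ` V \<subseteq> t ` B"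
  using assms(1,4,5)
proof (induction fs arbitrary: B t)
  case Nil
  then have "tree_labelling E V t" "t ` V \<subseteq> t ` B" by simp_all
  then show ?case by blast
next
  case (Cons f fs)
  obtain u w where f: "f = (u, w)" by fastforce
  note inv = Cons.prems(3)
  have uw: "u \<in> B" "w \<in> V - B" "E u w"
    and uniq: "\<And>x. (w, x) \<in> (edges_on E (V - B))\<^sup>* \<Longrightarrow> E u x \<Longrightarrow> x = w"
    using Cons.prems(1) f by (auto simp: forces_def)
  let ?B = "insert w B" and ?t = "t(w := t u)"
  have "tree_labelling E ?B ?t"
  proof (rule tree_labelling_insert_leaf[OF Cons.prems(2) assms(2,3)])
    show "y = u" if "y \<in> B" "E y w" "t y = t u" for y
      using inv[of y u w w] that uw by simp
  qed (use uw in auto)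
  moreover have "v = v'" if v: "v \<in> ?B" "v' \<in> ?B" "?t v = ?t v'" and x: "x \<in> V - ?B"
    "E v x" "E v' x'" and xx': "(x, x') \<in> (edges_on E (V - ?B))\<^sup>*" for v v' x x'
  proof -
    have R: "(x, x') \<in> (edges_on E (V - B))\<^sup>*"
      by (rule edges_on_rtrancl_mono[OF xx']) auto
    have x': "x' \<in> V - ?B" using edges_on_rtrancl_mem[OF xx' x(1)] .
    have R': "(x', x) \<in> (edges_on E (V - B))\<^sup>*" using edges_on_rtrancl_sym[OF assms(2) R] .
    \<comment> \<open>Here \<open>w\<close> and another vertex \<open>v1\<close> of its new class
      are attached to the same remaining white component. Before the force that component was part
      of the component of \<open>w\<close>, to which both \<open>u\<close> and \<open>v1\<close>
      were attached, so the invariant gives \<open>v1 = u\<close>; but \<open>w\<close> was the only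
      neighbour of \<open>u\<close> in it.\<close>
    have clash: False if "v1 \<in> B" "t v1 = t u" "E w y" "E v1 y'" "y \<in> V - ?B" "y' \<in> V - ?B"
      "(y, y') \<in> (edges_on E (V - B))\<^sup>*" for v1 y y'
    proof -
      have "(w, y) \<in> edges_on E (V - B)" using that uw by (auto simp: edges_on_def)
      then have wy': "(w, y') \<in> (edges_on E (V - B))\<^sup>*"
        using that(7) by (meson converse_rtrancl_into_rtrancl)
      then have "u = v1" using inv[of u v1 w y'] that uw by simp
      then show False using uniq[OF wy'] that by simp
    qed
    show ?thesis
    proof (cases "v = w"; cases "v' = w")
      assume "v \<noteq> w" "v' \<noteq> w"
      then show ?thesis using inv[of v v' x x'] v x R by auto
    next
      assume "v = w" "v' \<noteq> w"
      then show ?thesis using clash[of v' x x'] v x x' R by auto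
    next
      assume "v \<noteq> w" "v' = w"
      then show ?thesis using clash[of v x' x] v x x' R' by auto
    qed simp
  qed
  moreover have "process E V ?B fs" using Cons.prems(1) f by simp
  ultimately obtain t' where t': "tree_labelling E V t'" "t' ` V \<subseteq> ?t ` ?B"
    using Cons.IH[of ?B ?t] by blast
  moreover have "?t ` ?B \<subseteq> t ` B" using uw by auto
  ultimately show ?case by (intro exI[of _ t']) (simp add: order_trans)
qed

text \<open>Initially \<open>id\<close> makes each vertex of \<open>Z\<close> a tree of its own, and
  a forced vertex inherits the label of its forcer. So all labels stay in \<open>Z\<close>, which
  bounds the number of trees.\<close>

lemma process_tree_labelling:
  assumes "process E V Z fs" "symp E" "\<And>x. \<not> E x x"
  shows "\<exists>t. tree_labelling E V t \<and> t ` V \<subseteq> Z"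
proof -
  have "\<exists>t'. tree_labelling E V t' \<and> t' ` V \<subseteq> id ` Z"
    by (rule process_tree_labelling_aux[OF assms tree_labelling_id[OF assms(3)]]) simp_all
  then show ?thesis by simp
qed

lemma process_reaches_all:
  assumes "process E V B fs" "x \<in> V"
  shows "\<exists>z\<in>B. (z, x) \<in> (set fs)\<^sup>*"
  using assms(1)
proof (induction fs arbitrary: B)
  case Nil
  then show ?case using assms(2) by auto
next
  case (Cons f fs)
  obtain u w where f: "f = (u, w)" by fastforce
  then obtain z where z: "z \<in> insert w B" "(z, x) \<in> (set fs)\<^sup>*"
    using Cons.IH[of "insert w B"] Cons.prems by auto
  have zx: "(z, x) \<in> (set (f # fs))\<^sup>*"
    using z(2) rtrancl_mono[of "set fs" "set (f # fs)"] by auto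
  show ?case
  proof (cases "z = w")
    case True
    have "(u, z) \<in> set (f # fs)" using True f by simp
    then have "(u, x) \<in> (set (f # fs))\<^sup>*" using zx by (rule converse_rtrancl_into_rtrancl)
    moreover have "u \<in> B" using Cons.prems f by (simp add: forces_def)
    ultimately show ?thesis by blast
  next
    case False
    then show ?thesis using z(1) zx by blast
  qed
qed

text \<open>Forces preserve labels, so the forcing tree of \<open>z\<close> stays in its class.
  Conversely a vertex of that class is reached from some root with the same label, and injectivity
  of \<open>t\<close> on \<open>Z\<close> makes this root \<open>z\<close>.\<close>

lemma realizes_class:
  assumes r: "realizes E V t Z fs" and "z \<in> Z"
  shows "{v. (z, v) \<in> (set fs)\<^sup>*} = {v \<in> V. t v = t z}"
proof -
  have pr: "process E V Z fs" and inj: "inj_on t Z" and mono: "\<forall>(a, b)\<in>set fs. t a = t b"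
    using r unfolding realizes_def by blast+
  have step: "v \<in> V \<and> t v = t y" if "(y, v) \<in> (set fs)\<^sup>*" "y \<in> V" for y v
    using that
  proof (induction rule: rtrancl_induct)
    case (step a b)
    have "t a = t b" using mono step.hyps(2) by blast
    then show ?case using process_forces[OF pr step.hyps(2)] step.IH step.prems by simp
  qed simp
  have ZV: "Z \<subseteq> V" using process_subset[OF pr] .
  show ?thesis
  proof (intro equalityI subsetI)
    fix v assume "v \<in> {v. (z, v) \<in> (set fs)\<^sup>*}"
    then show "v \<in> {v \<in> V. t v = t z}" using step[of z v] ZV assms(2) by blast
  next
    fix v assume v: "v \<in> {v \<in> V. t v = t z}"
    then obtain y where y: "y \<in> Z" "(y, v) \<in> (set fs)\<^sup>*" using process_reaches_all[OF pr] by blast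
    then have "t y = t z" using step[of y v] ZV v by auto
    then have "y = z" using inj y(1) assms(2) by (simp add: inj_on_def)
    then show "v \<in> {v. (z, v) \<in> (set fs)\<^sup>*}" using y(2) by simp
  qed
qed

section \<open>Theta curves and drawings of the complete graph on four vertices\<close>

text \<open>Edges are handled as point sets with two ends: reversal is then invisible, concatenation
  is a union, and cycles are unions of two such sets.\<close>

definition arcset :: "complex set \<Rightarrow> complex \<Rightarrow> complex \<Rightarrow> bool" where
  "arcset A x y \<longleftrightarrow> (\<exists>g. arc g \<and> path_image g = A \<and> pathstart g = x \<and> pathfinish g = y)"

lemma arcset_sym: "arcset A x y \<Longrightarrow> arcset A y x"
  unfolding arcset_def
  by (metis arc_reversepath path_image_reversepath pathfinish_reversepath pathstart_reversepath)

lemma arcset_join: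
  assumes "arcset A x y" "arcset B y z" "A \<inter> B \<subseteq> {y}"
  shows "arcset (A \<union> B) x z"
proof -
  obtain g h where g: "arc g" "path_image g = A" "pathstart g = x" "pathfinish g = y"
    and h: "arc h" "path_image h = B" "pathstart h = y" "pathfinish h = z"
    using assms(1,2) unfolding arcset_def by blast
  have "arc (g +++ h)" using g h assms(3) by (intro arc_join) auto
  moreover have "path_image (g +++ h) = A \<union> B" using g h by (simp add: path_image_join)
  ultimately show ?thesis unfolding arcset_def using g h by (metis pathfinish_join pathstart_join)
qed

lemma arcset_ends: "arcset A x y \<Longrightarrow> x \<in> A \<and> y \<in> A \<and> x \<noteq> y"
  unfolding arcset_def by (metis arc_distinct_ends pathfinish_in_path_image pathstart_in_path_image)

lemma arcset_connected: "arcset A x y \<Longrightarrow> Topological_Spaces.connected A"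
  unfolding arcset_def by (metis arc_imp_path connected_path_image)

lemma arcset_compact: "arcset A x y \<Longrightarrow> compact A"
  unfolding arcset_def by (metis arc_imp_path compact_path_image)

lemma arcset_interior:
  assumes "arcset A x y"
  shows "Topological_Spaces.connected (A - {x, y})" "A \<subseteq> closure (A - {x, y})"
proof -
  obtain g where g: "arc g" "path_image g = A" "pathstart g = x" "pathfinish g = y"
    using assms unfolding arcset_def by blast
  then have sp: "simple_path g" by (simp add: arc_imp_simple_path)
  show "Topological_Spaces.connected (A - {x, y})" using connected_simple_path_endless[OF sp] g by simp
  have eq: "A - {x, y} = g ` {0<..<1}" using simple_path_endless[OF sp] g by simp
  have "continuous_on (closure {0<..<1}) g"
    using arc_imp_path[OF g(1)] by (simp add: path_def)
  then have "g ` closure {0<..<1} \<subseteq> closure (g ` {0<..<1})"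
    by (rule image_closure_subset) (auto simp: closure_subset)
  then show "A \<subseteq> closure (A - {x, y})"
    unfolding eq using g(2) by (simp add: path_image_def)
qed

lemma arcset_interior_nonempty: "arcset A x y \<Longrightarrow> A - {x, y} \<noteq> {}"
  using arcset_interior(2) arcset_ends by (metis closure_empty empty_iff subsetD)

section \<open>Jordan curves, theta curves and the exclusion of K4\<close>

definition jordan :: "complex set \<Rightarrow> bool" where
  "jordan J \<longleftrightarrow> (\<exists>c. simple_path c \<and> pathfinish c = pathstart c \<and> path_image c = J)"

lemma jordan_arcs:
  assumes "arcset A x y" "arcset B x y" "A \<inter> B \<subseteq> {x, y}"
  shows "jordan (A \<union> B)"
proof -
  obtain g h where g: "arc g" "path_image g = A" "pathstart g = x" "pathfinish g = y"
    and h: "arc h" "path_image h = B" "pathstart h = y" "pathfinish h = x"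
    using assms(1) arcset_sym[OF assms(2)] unfolding arcset_def by blast
  have "simple_path (g +++ h)" using g h assms(3) by (intro simple_path_join_loop) auto
  moreover have "path_image (g +++ h) = A \<union> B" using g h by (simp add: path_image_join)
  ultimately show ?thesis unfolding jordan_def using g h by (metis pathfinish_join pathstart_join)
qed

lemma jordan_props:
  assumes "jordan J"
  shows "inside J \<noteq> {}" "open (inside J)" "Topological_Spaces.connected (inside J)" "open (outside J)"
    "Topological_Spaces.connected (outside J)" "bounded (inside J)" "frontier (inside J) = J" "compact J"
proof -
  obtain c where c: "simple_path c" "pathfinish c = pathstart c" and J: "path_image c = J"
    using assms unfolding jordan_def by blast
  show "inside J \<noteq> {}" "open (inside J)" "Topological_Spaces.connected (inside J)" "open (outside J)"
    "Topological_Spaces.connected (outside J)" "bounded (inside J)" "frontier (inside J) = J"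
    using Jordan_inside_outside[OF c] unfolding J by blast+
  show "compact J" using J c(1) compact_simple_path_image by blast
qed

lemma jordan_side:
  assumes "jordan J" "Topological_Spaces.connected S" "S \<inter> J = {}"
  shows "S \<subseteq> inside J \<or> S \<subseteq> outside J"
proof -
  have "S \<subseteq> inside J \<union> outside J" using assms(3) inside_Un_outside[of J] by blast
  then show ?thesis
    using connectedD[OF assms(2) jordan_props(2,4)[OF assms(1)]] inside_Int_outside[of J] by blast
qed

lemma unbounded_subset_outside:
  fixes U :: "complex set"
  assumes "Topological_Spaces.connected U" "\<not> bounded U" "U \<inter> J = {}"
  shows "U \<subseteq> outside J"
proof
  fix x assume x: "x \<in> U"
  have "U \<subseteq> connected_component_set (- J) x"
    using assms x by (intro connected_component_maximal) auto
  then have "\<not> bounded (connected_component_set (- J) x)" using assms(2) bounded_subset by blast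
  then show "x \<in> outside J" using x assms(3) by (auto simp: outside_def)
qed

text \<open>The place where lying on the outer face is used: the inside of \<open>J\<close> is open,
  so a point of it in the closure of \<open>U\<close> would make \<open>U\<close> meet the inside,
  whereas \<open>U\<close> runs to infinity without crossing \<open>J\<close>.\<close>

lemma closure_unbounded_subset_outside:
  assumes "jordan J" "Topological_Spaces.connected U" "\<not> bounded U" "U \<inter> J = {}" "p \<in> closure U" "p \<notin> J"
  shows "p \<in> outside J"
proof (rule ccontr)
  assume "p \<notin> outside J"
  then have "p \<in> inside J" using inside_Un_outside[of J] assms(6) by blast
  then have "inside J \<inter> U \<noteq> {}"
    using assms(5) jordan_props(2)[OF assms(1)] open_Int_closure_eq_empty by blast
  then show False
    using unbounded_subset_outside[OF assms(2-4)] inside_Int_outside[of J] by blast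
qed

lemma inside_disjoint_arc:
  assumes "Z - {x, y} \<subseteq> outside J" "x \<in> J" "y \<in> J"
  shows "inside J \<inter> Z = {}"
proof -
  have "inside J \<inter> outside J = {}" "inside J \<inter> J = {}"
    by (simp_all add: inside_Int_outside inside_no_overlap)
  then show ?thesis using assms by blast
qed

text \<open>In a theta curve one of the three arcs lies inside the cycle formed by the other two:
  otherwise Janiszewski's theorem, applied to two cycles sharing the arc \<open>Z\<close>, would connect the
  inside of the third cycle to infinity.\<close>

lemma theta_arc_inside:
  assumes X: "arcset X x y" and Y: "arcset Y x y" and Z: "arcset Z x y"
    and XY: "X \<inter> Y \<subseteq> {x, y}" and XZ: "X \<inter> Z \<subseteq> {x, y}" and YZ: "Y \<inter> Z \<subseteq> {x, y}"
    and outX: "X - {x, y} \<subseteq> outside (Y \<union> Z)" and outY: "Y - {x, y} \<subseteq> outside (X \<union> Z)"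
    and outZ: "Z - {x, y} \<subseteq> outside (X \<union> Y)"
  shows False
proof -
  have jXY: "jordan (X \<union> Y)" and jXZ: "jordan (X \<union> Z)" and jYZ: "jordan (Y \<union> Z)"
    using jordan_arcs[OF X Y XY] jordan_arcs[OF X Z XZ] jordan_arcs[OF Y Z YZ] by simp_all
  have ends: "x \<in> X" "y \<in> X" "x \<in> Y" "y \<in> Y" "x \<in> Z" "y \<in> Z"
    using arcset_ends[OF X] arcset_ends[OF Y] arcset_ends[OF Z] by simp_all
  have disj: "inside (X \<union> Y) \<inter> Z = {}" "inside (X \<union> Z) \<inter> Y = {}" "inside (Y \<union> Z) \<inter> X = {}"
    using inside_disjoint_arc[OF outZ] inside_disjoint_arc[OF outY] inside_disjoint_arc[OF outX] ends
    by simp_all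
  \<comment> \<open>The inside of the cycle of \<open>X\<close> and \<open>Y\<close> meets none of
    the three arcs, so it lies on one side of the cycle of \<open>W\<close> and \<open>Z\<close>. On
    the inner side, the two insides would contain each other; their frontiers, the two cycles, would
    coincide, although \<open>W'\<close> has points off \<open>W\<close> and
    \<open>Z\<close>.\<close>
  have other: "inside (X \<union> Y) \<subseteq> outside (W \<union> Z)"
    if W: "W \<union> W' = X \<union> Y" "jordan (W \<union> Z)" "inside (W \<union> Z) \<inter> W' = {}"
      "W' - {x, y} \<noteq> {}" "W' \<inter> W \<subseteq> {x, y}" "W' \<inter> Z \<subseteq> {x, y}" for W W'
  proof (rule ccontr)
    assume "\<not> ?thesis"
    moreover have "inside (X \<union> Y) \<inter> (W \<union> Z) = {}"
      using disj(1) W(1) inside_no_overlap[of "X \<union> Y"] by blast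
    ultimately have 1: "inside (X \<union> Y) \<subseteq> inside (W \<union> Z)"
      using jordan_side[OF W(2) jordan_props(3)[OF jXY]] by blast
    have "inside (W \<union> Z) \<inter> (X \<union> Y) = {}"
      using W(1,3) inside_no_overlap[of "W \<union> Z"] by blast
    then have "inside (W \<union> Z) \<subseteq> inside (X \<union> Y)"
      using jordan_side[OF jXY jordan_props(3)[OF W(2)]] 1 jordan_props(1)[OF jXY]
        inside_Int_outside[of "X \<union> Y"] by blast
    then have "X \<union> Y = W \<union> Z"
      using 1 jordan_props(7)[OF jXY] jordan_props(7)[OF W(2)] by (metis subset_antisym)
    then show False using W by blast
  qed
  have nX: "X - {x, y} \<noteq> {}" and nY: "Y - {x, y} \<noteq> {}"
    using arcset_interior_nonempty[OF X] arcset_interior_nonempty[OF Y] by simp_all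
  have in1: "inside (X \<union> Y) \<subseteq> outside (X \<union> Z)"
    by (rule other[of X Y]) (use jXZ disj nY XY YZ in auto)
  have in2: "inside (X \<union> Y) \<subseteq> outside (Y \<union> Z)"
    by (rule other[of Y X]) (use jYZ disj nX XY XZ in auto)
  obtain i where i: "i \<in> inside (X \<union> Y)" using jordan_props(1)[OF jXY] by blast
  have cT: "compact (X \<union> Y \<union> Z)" using arcset_compact[OF X] arcset_compact[OF Y] arcset_compact[OF Z] by (intro compact_Un)
  then obtain u where u: "u \<in> outside (X \<union> Y \<union> Z)"
    using unbounded_outside[of "X \<union> Y \<union> Z"] compact_imp_bounded bounded_empty by (metis ex_in_conv)
  have uo: "u \<in> outside (X \<union> Y)" "u \<in> outside (X \<union> Z)" "u \<in> outside (Y \<union> Z)"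
    using u outside_mono[of "X \<union> Y" "X \<union> Y \<union> Z"] outside_mono[of "X \<union> Z" "X \<union> Y \<union> Z"]
      outside_mono[of "Y \<union> Z" "X \<union> Y \<union> Z"] by blast+
  have conn: "connected_component (- J) i u" if "jordan J" "i \<in> outside J" "u \<in> outside J" for J
    unfolding connected_component_def
    using that jordan_props(5)[of J] outside_no_overlap[of J] by blast
  \<comment> \<open>The two cycles meet in a connected set, as Janiszewski's theorem requires.
    Neither separates \<open>i\<close> from the far point \<open>u\<close>, so their union does not
    either; yet the cycle of \<open>X\<close> and \<open>Y\<close> does.\<close>
  have "(X \<union> Z) \<inter> (Y \<union> Z) = Z" using XY ends by blast
  then have "connected_component (- ((X \<union> Z) \<union> (Y \<union> Z))) i u"
    using Janiszewski[of "X \<union> Z" "Y \<union> Z" i u] arcset_connected[OF Z] conn jXZ jYZ in1 in2 i uo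
      jordan_props(8) compact_imp_closed by (metis subsetD)
  then obtain C where C: "Topological_Spaces.connected C" "i \<in> C" "u \<in> C" "C \<subseteq> - ((X \<union> Z) \<union> (Y \<union> Z))"
    unfolding connected_component_def by blast
  then have "C \<subseteq> inside (X \<union> Y) \<or> C \<subseteq> outside (X \<union> Y)"
    using jordan_side[OF jXY C(1)] by blast
  then show False using C i uo(1) inside_Int_outside[of "X \<union> Y"] by blast
qed

lemma split_inside_arcs:
  assumes X: "arcset X x y" and Y: "arcset Y x y" and Z: "arcset Z x y"
    and XY: "X \<inter> Y \<subseteq> {x, y}" and XZ: "X \<inter> Z \<subseteq> {x, y}" and YZ: "Y \<inter> Z \<subseteq> {x, y}"
    and inZ: "Z - {x, y} \<subseteq> inside (X \<union> Y)"
  shows "inside (X \<union> Y) = inside (X \<union> Z) \<union> inside (Y \<union> Z) \<union> (Z - {x, y})"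
proof -
  have ends: "x \<in> X" "y \<in> X" "x \<in> Y" "y \<in> Y" "x \<in> Z" "y \<in> Z" "x \<noteq> y"
    using arcset_ends[OF X] arcset_ends[OF Y] arcset_ends[OF Z] by simp_all
  obtain f g h where f: "arc f" "path_image f = X" "pathstart f = x" "pathfinish f = y"
    and g: "arc g" "path_image g = Y" "pathstart g = x" "pathfinish g = y"
    and h: "arc h" "path_image h = Z" "pathstart h = x" "pathfinish h = y"
    using X Y Z unfolding arcset_def by blast
  have "Z \<inter> inside (X \<union> Y) \<noteq> {}" using inZ arcset_interior_nonempty[OF Z] by blast
  moreover have "X \<inter> Y = {x, y}" "X \<inter> Z = {x, y}" "Y \<inter> Z = {x, y}"
    using XY XZ YZ ends by blast+
  ultimately show ?thesis
    using split_inside_simple_closed_curve[of f x y g h] f g h ends(7) arc_imp_simple_path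
    by metis
qed

text \<open>The three paths from \<open>a\<close> to \<open>c\<close> form a theta curve. Each of
  the outer vertices \<open>b\<close> and \<open>d\<close> shows that its own path lies outside the
  cycle formed by the other two; since not all three paths can lie outside, the chord is the inner
  one.\<close>

lemma chord_inside:
  assumes AB: "arcset AB a b" and BC: "arcset BC b c" and CD: "arcset CD c d" and AD: "arcset AD a d"
    and AC: "arcset AC a c"
    and d1: "AB \<inter> BC \<subseteq> {b}" "CD \<inter> AD \<subseteq> {d}" "AB \<inter> AD \<subseteq> {a}" "BC \<inter> CD \<subseteq> {c}"
      "AB \<inter> CD = {}" "BC \<inter> AD = {}"
    and d2: "AC \<inter> AB \<subseteq> {a}" "AC \<inter> AD \<subseteq> {a}" "AC \<inter> BC \<subseteq> {c}" "AC \<inter> CD \<subseteq> {c}"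
    and U: "Topological_Spaces.connected U" "\<not> bounded U" "U \<inter> (AB \<union> BC \<union> CD \<union> AD \<union> AC) = {}"
    and cl: "b \<in> closure U" "d \<in> closure U"
  shows "AC - {a, c} \<subseteq> inside ((AB \<union> BC) \<union> (AD \<union> CD))"
    and "b \<in> outside ((AD \<union> CD) \<union> AC)" and "d \<in> outside ((AB \<union> BC) \<union> AC)"
    and "inside ((AB \<union> BC) \<union> (AD \<union> CD)) =
      inside ((AB \<union> BC) \<union> AC) \<union> inside ((AD \<union> CD) \<union> AC) \<union> (AC - {a, c})"
proof -
  let ?X = "AB \<union> BC" and ?Y = "AD \<union> CD"
  have X: "arcset ?X a c" and Y: "arcset ?Y a c"
    using arcset_join[OF AB BC d1(1)] arcset_join[OF AD arcset_sym[OF CD]] d1(2) by (simp_all add: Int_commute)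
  have int: "?X \<inter> ?Y \<subseteq> {a, c}" "?X \<inter> AC \<subseteq> {a, c}" "?Y \<inter> AC \<subseteq> {a, c}"
    subgoal using d1(3-6) by blast
    subgoal using d2(1,3) by blast
    subgoal using d2(2,4) by blast
    done
  have ends: "b \<in> AB" "b \<in> BC" "d \<in> AD" "d \<in> CD" "a \<noteq> b" "b \<noteq> c" "c \<noteq> d" "a \<noteq> d"
    using arcset_ends[OF AB] arcset_ends[OF BC] arcset_ends[OF CD] arcset_ends[OF AD] by simp_all
  have b: "b \<notin> ?Y \<union> AC" using ends d1(5,6) d2(1) by blast
  have d: "d \<notin> ?X \<union> AC" using ends d1(5,6) d2(2) by blast
  have jXA: "jordan (?X \<union> AC)" and jYA: "jordan (?Y \<union> AC)" and jXY: "jordan (?X \<union> ?Y)"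
    using jordan_arcs[OF X AC int(2)] jordan_arcs[OF Y AC int(3)] jordan_arcs[OF X Y int(1)]
    by simp_all
  show bo: "b \<in> outside (?Y \<union> AC)"
    by (rule closure_unbounded_subset_outside[OF jYA U(1,2)]) (use U(3) cl b in auto)
  show do: "d \<in> outside (?X \<union> AC)"
    by (rule closure_unbounded_subset_outside[OF jXA U(1,2)]) (use U(3) cl d in auto)
  have oX: "?X - {a, c} \<subseteq> outside (?Y \<union> AC)"
    using jordan_side[OF jYA arcset_interior(1)[OF X]] bo b ends int
      inside_Int_outside[of "?Y \<union> AC"] by blast
  have oY: "?Y - {a, c} \<subseteq> outside (?X \<union> AC)"
    using jordan_side[OF jXA arcset_interior(1)[OF Y]] do d ends int
      inside_Int_outside[of "?X \<union> AC"] by blast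
  show inA: "AC - {a, c} \<subseteq> inside (?X \<union> ?Y)"
    using jordan_side[OF jXY arcset_interior(1)[OF AC]] int
      theta_arc_inside[OF X Y AC int oX oY] by blast
  show "inside (?X \<union> ?Y) = inside (?X \<union> AC) \<union> inside (?Y \<union> AC) \<union> (AC - {a, c})"
    by (rule split_inside_arcs[OF X Y AC int inA])
qed

text \<open>The diagonal \<open>AC\<close> cuts the inside of the four-cycle into two parts. The
  other diagonal is inside as well and avoids \<open>AC\<close>, so it stays in one part. Both
  \<open>b\<close> and \<open>d\<close> are limits of it, but each part has one of them in the open
  outside of its boundary cycle.\<close>

lemma no_outerplanar_K4:
  assumes AB: "arcset AB a b" and BC: "arcset BC b c" and CD: "arcset CD c d" and AD: "arcset AD a d"
    and AC: "arcset AC a c" and BD: "arcset BD b d"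
    and d1: "AB \<inter> BC \<subseteq> {b}" "CD \<inter> AD \<subseteq> {d}" "AB \<inter> AD \<subseteq> {a}" "BC \<inter> CD \<subseteq> {c}"
      "AB \<inter> CD = {}" "BC \<inter> AD = {}"
    and d2: "AC \<inter> AB \<subseteq> {a}" "AC \<inter> AD \<subseteq> {a}" "AC \<inter> BC \<subseteq> {c}" "AC \<inter> CD \<subseteq> {c}"
    and d3: "BD \<inter> AB \<subseteq> {b}" "BD \<inter> BC \<subseteq> {b}" "BD \<inter> CD \<subseteq> {d}" "BD \<inter> AD \<subseteq> {d}"
      "AC \<inter> BD = {}"
    and U: "Topological_Spaces.connected U" "\<not> bounded U" "U \<inter> (AB \<union> BC \<union> CD \<union> AD \<union> AC \<union> BD) = {}"
    and cl: "{a, b, c, d} \<subseteq> closure U"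
  shows False
proof -
  let ?X = "AB \<union> BC" and ?Y = "AD \<union> CD"
  have ac: "b \<in> outside (?Y \<union> AC)" "d \<in> outside (?X \<union> AC)"
    "inside (?X \<union> ?Y) = inside (?X \<union> AC) \<union> inside (?Y \<union> AC) \<union> (AC - {a, c})"
    by (rule chord_inside[OF AB BC CD AD AC d1 d2 U(1,2)]; use U(3) cl in auto)+
  have X: "arcset ?X a c" and Y: "arcset ?Y a c"
    using arcset_join[OF AB BC d1(1)] arcset_join[OF AD arcset_sym[OF CD]] d1(2) by (simp_all add: Int_commute)
  have int: "?X \<inter> AC \<subseteq> {a, c}" "?Y \<inter> AC \<subseteq> {a, c}"
    subgoal using d2(1,3) by blast
    subgoal using d2(2,4) by blast
    done
  have jXA: "jordan (?X \<union> AC)" and jYA: "jordan (?Y \<union> AC)"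
    using jordan_arcs[OF X AC int(1)] jordan_arcs[OF Y AC int(2)] by simp_all
  \<comment> \<open>The same lemma for the four-cycle read from \<open>b\<close>, where
    \<open>BD\<close> is the chord and \<open>a\<close>, \<open>c\<close> are the outer
    vertices.\<close>
  have "BD - {b, d} \<subseteq> inside ((BC \<union> CD) \<union> (AB \<union> AD))"
    by (rule chord_inside(1)[OF BC CD arcset_sym[OF AD] arcset_sym[OF AB] BD])
      (use d1 d3 U cl in auto)
  also have "(BC \<union> CD) \<union> (AB \<union> AD) = ?X \<union> ?Y" by blast
  finally have BDin: "BD - {b, d} \<subseteq> inside (?X \<union> AC) \<union> inside (?Y \<union> AC)"
    using ac(3) d3(5) by blast
  have endsBD: "b \<in> closure (BD - {b, d})" "d \<in> closure (BD - {b, d})"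
    using arcset_interior(2)[OF BD] arcset_ends[OF BD] by blast+
  have con: "Topological_Spaces.connected (BD - {b, d})" using arcset_interior(1)[OF BD] .
  have dis: "(BD - {b, d}) \<inter> (?X \<union> AC) = {}" "(BD - {b, d}) \<inter> (?Y \<union> AC) = {}"
    using d3 by blast+
  have no: "False" if "BD - {b, d} \<subseteq> inside J" "p \<in> closure (BD - {b, d})" "p \<in> outside J" "jordan J"
    for p J
  proof -
    have "outside J \<inter> (BD - {b, d}) \<noteq> {}"
      using that jordan_props(4)[OF that(4)] open_Int_closure_eq_empty by blast
    then show False using that(1) inside_Int_outside[of J] by blast
  qed
  have oX: "BD - {b, d} \<subseteq> outside (?X \<union> AC)"
    using jordan_side[OF jXA con dis(1)] no[of "?X \<union> AC" d] endsBD ac jXA by blast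
  have oY: "BD - {b, d} \<subseteq> outside (?Y \<union> AC)"
    using jordan_side[OF jYA con dis(2)] no[of "?Y \<union> AC" b] endsBD ac jYA by blast
  show False
    using BDin oX oY inside_Int_outside[of "?X \<union> AC"] inside_Int_outside[of "?Y \<union> AC"]
      arcset_interior_nonempty[OF BD] by blast
qed

section \<open>Outerplanar drawings and vertices of degree at most two\<close>

text \<open>\<open>U\<close> need not be a face: any unbounded connected set disjoint from the drawing will do, so that the
  notion passes to smaller drawings with the same \<open>U\<close>.\<close>

definition outer_drawing ::
  "('a \<Rightarrow> 'a \<Rightarrow> bool) \<Rightarrow> 'a set \<Rightarrow> ('a \<Rightarrow> complex) \<Rightarrow> ('a \<Rightarrow> 'a \<Rightarrow> complex set) \<Rightarrow> complex set \<Rightarrow> bool" where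
  "outer_drawing E V p A U \<longleftrightarrow> inj_on p V \<and>
     (\<forall>x\<in>V. \<forall>y\<in>V. E x y \<longrightarrow> arcset (A x y) (p x) (p y) \<and> A x y = A y x \<and>
        A x y \<inter> p ` V = {p x, p y} \<and> A x y \<inter> U = {}) \<and>
     (\<forall>x\<in>V. \<forall>y\<in>V. \<forall>x'\<in>V. \<forall>y'\<in>V. E x y \<and> E x' y' \<and> {x, y} \<noteq> {x', y'} \<longrightarrow>
        A x y \<inter> A x' y' \<subseteq> p ` ({x, y} \<inter> {x', y'})) \<and>
     Topological_Spaces.connected U \<and> \<not> bounded U \<and> p ` V \<subseteq> closure U"

lemma outer_drawing_edge:
  assumes "outer_drawing E V p A U" "x \<in> V" "y \<in> V" "E x y"
  shows "arcset (A x y) (p x) (p y)" "A x y = A y x" "A x y \<inter> p ` V = {p x, p y}" "A x y \<inter> U = {}"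
proof -
  have "\<forall>x\<in>V. \<forall>y\<in>V. E x y \<longrightarrow> arcset (A x y) (p x) (p y) \<and> A x y = A y x \<and>
      A x y \<inter> p ` V = {p x, p y} \<and> A x y \<inter> U = {}"
    using assms(1) unfolding outer_drawing_def by (elim conjE)
  then show "arcset (A x y) (p x) (p y)" "A x y = A y x" "A x y \<inter> p ` V = {p x, p y}" "A x y \<inter> U = {}"
    using assms(2-4) by blast+
qed

lemma outer_drawing_cross:
  assumes "outer_drawing E V p A U" "x \<in> V" "y \<in> V" "x' \<in> V" "y' \<in> V" "E x y" "E x' y'"
    "{x, y} \<noteq> {x', y'}"
  shows "A x y \<inter> A x' y' \<subseteq> p ` ({x, y} \<inter> {x', y'})"
  using assms unfolding outer_drawing_def by blast

lemma outer_drawing_global: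
  assumes "outer_drawing E V p A U"
  shows "inj_on p V" "Topological_Spaces.connected U" "\<not> bounded U" "p ` V \<subseteq> closure U"
  using assms unfolding outer_drawing_def by blast+

lemma outer_drawing_subset:
  assumes d: "outer_drawing E V p A U" and "W \<subseteq> V"
  shows "outer_drawing E W p A U"
  unfolding outer_drawing_def
proof (intro conjI ballI impI)
  show "inj_on p W" using outer_drawing_global(1)[OF d] \<open>W \<subseteq> V\<close> by (rule inj_on_subset)
  show "Topological_Spaces.connected U" "\<not> bounded U"
    using outer_drawing_global[OF d] by blast+
  show "p ` W \<subseteq> closure U" using outer_drawing_global(4)[OF d] \<open>W \<subseteq> V\<close> by blast
next
  fix x y assume xy: "x \<in> W" "y \<in> W" "E x y"
  then have "x \<in> V" "y \<in> V" using \<open>W \<subseteq> V\<close> by auto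
  note e = outer_drawing_edge[OF d this xy(3)]
  show "arcset (A x y) (p x) (p y)" "A x y = A y x" "A x y \<inter> U = {}" by (fact e)+
  show "A x y \<inter> p ` W = {p x, p y}" using e(3) xy \<open>W \<subseteq> V\<close> by blast
next
  fix x y x' y' assume "x \<in> W" "y \<in> W" "x' \<in> W" "y' \<in> W" "E x y \<and> E x' y' \<and> {x, y} \<noteq> {x', y'}"
  then show "A x y \<inter> A x' y' \<subseteq> p ` ({x, y} \<inter> {x', y'})"
    using outer_drawing_cross[OF d, of x y x' y'] \<open>W \<subseteq> V\<close> by blast
qed

lemma deg_le2_fill_unique:
  assumes "deg_le2 E V v" "x \<in> V" "y \<in> V" "x' \<in> V" "y' \<in> V" "x \<noteq> y" "x' \<noteq> y'"
    "E v x" "E v y" "E v x'" "E v y'"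
  shows "{x, y} = {x', y'}"
proof -
  have "x' = x \<or> x' = y" "y' = x \<or> y' = y" using assms unfolding deg_le2_def by metis+
  then show ?thesis using \<open>x' \<noteq> y'\<close> by auto
qed

text \<open>Only the missing edge between the two neighbours of \<open>v\<close> has to be drawn; it follows the
  path through \<open>v\<close>.\<close>

lemma outer_drawing_eliminate:
  assumes d: "outer_drawing E V p A U" and "v \<in> V" "symp E" "deg_le2 E V v"
  shows "outer_drawing (eliminate v E) (V - {v}) p
    (\<lambda>x y. if E x y then A x y else A v x \<union> A v y) U"
proof -
  let ?A = "\<lambda>x y. if E x y then A x y else A v x \<union> A v y"
  have new: "arcset (A v x \<union> A v y) (p x) (p y)" "(A v x \<union> A v y) \<inter> p ` (V - {v}) = {p x, p y}"
    "(A v x \<union> A v y) \<inter> U = {}"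
    if xy: "x \<in> V - {v}" "y \<in> V - {v}" "E v x" "E v y" "x \<noteq> y" for x y
  proof -
    have V: "x \<in> V" "y \<in> V" using xy by auto
    note ex = outer_drawing_edge[OF d \<open>v \<in> V\<close> V(1) xy(3)]
    note ey = outer_drawing_edge[OF d \<open>v \<in> V\<close> V(2) xy(4)]
    have "{v, x} \<noteq> {v, y}" using xy by auto
    then have "A v x \<inter> A v y \<subseteq> p ` ({v, x} \<inter> {v, y})"
      using outer_drawing_cross[OF d \<open>v \<in> V\<close> V(1) \<open>v \<in> V\<close> V(2) xy(3,4)] by blast
    also have "{v, x} \<inter> {v, y} = {v}" using xy by auto
    finally have "A v x \<inter> A v y \<subseteq> {p v}" by simp
    then show "arcset (A v x \<union> A v y) (p x) (p y)"
      by (intro arcset_join[of _ _ "p v"] arcset_sym[OF ex(1)] ey(1))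
    \<comment> \<open>The new arc passes through the point of \<open>v\<close>, which is harmless
      because \<open>v\<close> is no longer a drawn vertex.\<close>
    have "p ` (V - {v}) = p ` V - {p v}"
      using inj_on_image_set_diff[OF outer_drawing_global(1)[OF d], of V "{v}"] \<open>v \<in> V\<close> by auto
    moreover have "p x \<noteq> p v" "p y \<noteq> p v"
      using arcset_ends[OF ex(1)] arcset_ends[OF ey(1)] by auto
    ultimately show "(A v x \<union> A v y) \<inter> p ` (V - {v}) = {p x, p y}"
      using ex(3) ey(3) by auto
    show "(A v x \<union> A v y) \<inter> U = {}" using ex(4) ey(4) by blast
  qed
  have old_new: "A x y \<inter> (A v x' \<union> A v y') \<subseteq> p ` ({x, y} \<inter> {x', y'})"
    if "x \<in> V - {v}" "y \<in> V - {v}" "x' \<in> V - {v}" "y' \<in> V - {v}" "E x y" "E v x'" "E v y'"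
    for x y x' y'
  proof -
    have "A x y \<inter> A v z \<subseteq> p ` ({x, y} \<inter> {z})" if "z \<in> V - {v}" "E v z" for z
    proof -
      have "v \<notin> {x, y}" using \<open>x \<in> V - {v}\<close> \<open>y \<in> V - {v}\<close> by blast
      then have "{x, y} \<noteq> {v, z}" by blast
      then have "A x y \<inter> A v z \<subseteq> p ` ({x, y} \<inter> {v, z})"
        using outer_drawing_cross[OF d, of x y v z] that \<open>x \<in> V - {v}\<close> \<open>y \<in> V - {v}\<close> \<open>E x y\<close> \<open>v \<in> V\<close>
        by auto
      moreover have "{x, y} \<inter> {v, z} = {x, y} \<inter> {z}"
        using \<open>x \<in> V - {v}\<close> \<open>y \<in> V - {v}\<close> by auto
      ultimately show ?thesis by simp
    qed
    from this[OF that(3,6)] this[OF that(4,7)] show ?thesis by blast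
  qed
  have symE: "E x y \<longleftrightarrow> E y x" for x y using sympD[OF \<open>symp E\<close>] by blast
  show ?thesis
    unfolding outer_drawing_def
  proof (intro conjI ballI impI)
    show "inj_on p (V - {v})" using outer_drawing_global(1)[OF d] by (rule inj_on_subset) blast
    show "Topological_Spaces.connected U" "\<not> bounded U" using outer_drawing_global[OF d] by blast+
    show "p ` (V - {v}) \<subseteq> closure U" using outer_drawing_global(4)[OF d] by blast
  next
    fix x y assume xy: "x \<in> V - {v}" "y \<in> V - {v}" "eliminate v E x y"
    show "arcset (?A x y) (p x) (p y)" "?A x y = ?A y x" "?A x y \<inter> p ` (V - {v}) = {p x, p y}"
      "?A x y \<inter> U = {}"
    proof -
      consider "E x y" | "\<not> E x y" "E v x" "E v y" "x \<noteq> y" using xy by (auto simp: eliminate_def)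
      then have "arcset (?A x y) (p x) (p y) \<and> ?A x y = ?A y x \<and>
        ?A x y \<inter> p ` (V - {v}) = {p x, p y} \<and> ?A x y \<inter> U = {}"
      proof cases
        case 1
        note e = outer_drawing_edge[OF outer_drawing_subset[OF d Diff_subset] xy(1,2) 1]
        show ?thesis using e 1 symE[of x y] by simp
      next
        case 2
        show ?thesis using new[OF xy(1,2) 2(2-4)] 2(1) symE[of x y] by (simp add: Un_commute)
      qed
      then show "arcset (?A x y) (p x) (p y)" "?A x y = ?A y x" "?A x y \<inter> p ` (V - {v}) = {p x, p y}"
        "?A x y \<inter> U = {}" by blast+
    qed
  next
    fix x y x' y'
    assume V: "x \<in> V - {v}" "y \<in> V - {v}" "x' \<in> V - {v}" "y' \<in> V - {v}"
      and e: "eliminate v E x y \<and> eliminate v E x' y' \<and> {x, y} \<noteq> {x', y'}"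
    show "?A x y \<inter> ?A x' y' \<subseteq> p ` ({x, y} \<inter> {x', y'})"
    proof (cases "E x y"; cases "E x' y'")
      assume "E x y" "E x' y'"
      then show ?thesis using outer_drawing_cross[OF d, of x y x' y'] V e by simp
    next
      assume h: "E x y" "\<not> E x' y'"
      then show ?thesis using old_new[OF V] e by (simp add: eliminate_def)
    next
      assume h: "\<not> E x y" "E x' y'"
      then have "A x' y' \<inter> (A v x \<union> A v y) \<subseteq> p ` ({x', y'} \<inter> {x, y})"
        using old_new[OF V(3,4,1,2)] e by (simp add: eliminate_def)
      then show ?thesis using h by (simp add: Int_commute)
    next
      assume "\<not> E x y" "\<not> E x' y'"
      then have "{x, y} = {x', y'}"
        using deg_le2_fill_unique[OF \<open>deg_le2 E V v\<close>, of x y x' y'] V e by (auto simp: eliminate_def)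
      then show ?thesis using e by blast
    qed
  qed
qed

section \<open>Longest paths and chords in graphs of minimum degree three\<close>

definition lpath :: "('a \<Rightarrow> 'a \<Rightarrow> bool) \<Rightarrow> 'a set \<Rightarrow> 'a list \<Rightarrow> bool" where
  "lpath E V xs \<longleftrightarrow> distinct xs \<and> set xs \<subseteq> V \<and>
     (\<forall>k. Suc k < length xs \<longrightarrow> E (xs ! k) (xs ! Suc k))"

text \<open>Posa's rotation: if vertex \<open>0\<close> of the path is adjacent to vertex
  \<open>i\<close>, the result is a path on the same vertices that starts at the old vertex
  \<open>i - 1\<close>.\<close>

definition flip_prefix :: "nat \<Rightarrow> 'a list \<Rightarrow> 'a list" where
  "flip_prefix i xs = rev (take i xs) @ drop i xs"

lemma length_flip_prefix: "length (flip_prefix i xs) = length xs"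
  by (simp add: flip_prefix_def)

lemma nth_flip_prefix:
  assumes "i < length xs"
  shows "k < i \<Longrightarrow> flip_prefix i xs ! k = xs ! (i - Suc k)"
    and "i \<le> k \<Longrightarrow> k < length xs \<Longrightarrow> flip_prefix i xs ! k = xs ! k"
  using assms by (simp_all add: flip_prefix_def nth_append rev_nth)

lemma lpath_flip_prefix:
  assumes xs: "lpath E V xs" and "symp E" and i: "0 < i" "i < length xs" "E (xs ! 0) (xs ! i)"
  shows "lpath E V (flip_prefix i xs)"
  unfolding lpath_def
proof (intro conjI allI impI)
  have "distinct (take i xs @ drop i xs)" using xs by (simp add: lpath_def)
  then show "distinct (flip_prefix i xs)" unfolding flip_prefix_def by (simp only: distinct_append distinct_rev set_rev)
  have "set (take i xs @ drop i xs) \<subseteq> V" using xs by (simp add: lpath_def)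
  then show "set (flip_prefix i xs) \<subseteq> V" unfolding flip_prefix_def by (simp only: set_append set_rev)
  fix k assume k: "Suc k < length (flip_prefix i xs)"
  have E: "E (xs ! l) (xs ! Suc l)" if "Suc l < length xs" for l
    using xs that by (simp add: lpath_def)
  consider "Suc k < i" | "Suc k = i" | "i \<le> k" by linarith
  then show "E (flip_prefix i xs ! k) (flip_prefix i xs ! Suc k)"
  proof cases
    case 1
    then have "i - Suc k = Suc (i - Suc (Suc k))" by simp
    then show ?thesis
      using 1 E[of "i - Suc (Suc k)"] i(2) sympD[OF \<open>symp E\<close>]
      by (simp add: nth_flip_prefix(1)[OF i(2)])
  next
    case 2
    then show ?thesis
      using i k nth_flip_prefix(1)[OF i(2), of k] nth_flip_prefix(2)[OF i(2), of i]
      by (simp add: length_flip_prefix)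
  next
    case 3
    then show ?thesis using E[of k] k by (simp add: length_flip_prefix nth_flip_prefix(2)[OF i(2)])
  qed
qed

lemma longest_lpath_exists:
  assumes "finite V" "V \<noteq> {}"
  obtains xs where "lpath E V xs" "xs \<noteq> []" "\<And>ys. lpath E V ys \<Longrightarrow> length ys \<le> length xs"
proof -
  have fin: "finite (length ` {xs. lpath E V xs})"
  proof (rule finite_subset[of _ "{..card V}"])
    show "length ` {xs. lpath E V xs} \<subseteq> {..card V}"
      using \<open>finite V\<close> by (auto simp: lpath_def) (metis card_mono distinct_card)
  qed simp
  obtain v where "v \<in> V" using \<open>V \<noteq> {}\<close> by blast
  then have v: "lpath E V [v]" by (simp add: lpath_def)
  have "Max (length ` {xs. lpath E V xs}) \<in> length ` {xs. lpath E V xs}"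
    using fin v by (intro Max_in) auto
  then obtain xs where xs: "lpath E V xs" "length xs = Max (length ` {xs. lpath E V xs})" by auto
  have max: "length ys \<le> length xs" if "lpath E V ys" for ys
    unfolding xs(2) using fin that by (intro Max_ge) auto
  then have "xs \<noteq> []" using max[OF v] by auto
  then show ?thesis using that xs(1) max by blast
qed

text \<open>Otherwise \<open>w\<close> could be put in front of the path; position \<open>0\<close>
  is ruled out because there are no loops.\<close>

lemma longest_lpath_neighbour:
  assumes xs: "lpath E V xs" "xs \<noteq> []" and max: "\<And>ys. lpath E V ys \<Longrightarrow> length ys \<le> length xs"
    and "symp E" "\<And>x. \<not> E x x" and w: "w \<in> V" "E (xs ! 0) w"
  obtains k where "0 < k" "k < length xs" "xs ! k = w"
proof -
  have "w \<in> set xs"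
  proof (rule ccontr)
    assume "w \<notin> set xs"
    moreover have "E ((w # xs) ! k) ((w # xs) ! Suc k)" if "Suc k < length (w # xs)" for k
    proof (cases k)
      case 0
      then show ?thesis using w sympD[OF \<open>symp E\<close>, of "xs ! 0" w] by simp
    next
      case (Suc l)
      then show ?thesis using xs(1) that by (simp add: lpath_def)
    qed
    ultimately have "lpath E V (w # xs)" using xs(1) w(1) by (simp add: lpath_def)
    then show False using max[of "w # xs"] by simp
  qed
  then obtain k where k: "k < length xs" "xs ! k = w" by (auto simp: in_set_conv_nth)
  moreover have "k \<noteq> 0" using k(2) w(2) assms(5) by metis
  ultimately show ?thesis using that by blast
qed

text \<open>On a longest path every neighbour of the first vertex lies on the path. Let \<open>i \<ge> 2\<close> be minimal
  such that the first vertex of some longest path is adjacent to vertex \<open>i\<close> of that path.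
  Reversing the first \<open>i\<close> vertices gives another longest path, and minimality of \<open>i\<close> forces a further
  neighbour beyond \<open>i\<close> for the first vertex of both paths.\<close>

lemma min_degree_3_chords:
  assumes "finite V" "V \<noteq> {}" "symp E" "\<And>x. \<not> E x x" and deg: "\<And>v. v \<in> V \<Longrightarrow> \<not> deg_le2 E V v"
  obtains xs i j m where "lpath E V xs" "2 \<le> i" "i < j" "i < m" "j < length xs" "m < length xs"
    "E (xs ! 0) (xs ! i)" "E (xs ! 0) (xs ! j)" "E (xs ! (i - 1)) (xs ! m)"
proof -
  obtain xs0 where xs0: "lpath E V xs0" "xs0 \<noteq> []"
    and max0: "\<And>ys. lpath E V ys \<Longrightarrow> length ys \<le> length xs0"
    using longest_lpath_exists[OF assms(1,2)] by blast
  define L where "L = length xs0"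
  have "1 \<le> L" using xs0(2) by (cases xs0) (simp_all add: L_def)
  have maxL: "length ys \<le> L" if "lpath E V ys" for ys using max0[OF that] by (simp add: L_def)
  define P where "P i \<longleftrightarrow> 2 \<le> i \<and> i < L \<and>
    (\<exists>xs. lpath E V xs \<and> length xs = L \<and> E (xs ! 0) (xs ! i))" for i
  have three: "\<exists>a b c. distinct [0, a, b, c] \<and> (\<forall>k\<in>{a, b, c}. k < L \<and> E (xs ! 0) (xs ! k))"
    if xs: "lpath E V xs" "length xs = L" for xs
  proof -
    have "xs ! 0 \<in> set xs" using xs(2) \<open>1 \<le> L\<close> by simp
    then have "xs ! 0 \<in> V" using xs(1) by (auto simp: lpath_def)
    then obtain x y z where xyz: "x \<in> V" "y \<in> V" "z \<in> V" "E (xs ! 0) x" "E (xs ! 0) y" "E (xs ! 0) z"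
      "x \<noteq> y" "y \<noteq> z" "x \<noteq> z"
      using deg[of "xs ! 0"] unfolding deg_le2_def by blast
    have "xs \<noteq> []" using xs(2) \<open>1 \<le> L\<close> by auto
    then have idx: "\<exists>k<L. k \<noteq> 0 \<and> xs ! k = w" if w: "w \<in> V" "E (xs ! 0) w" for w
      using longest_lpath_neighbour[OF xs(1) _ _ assms(3,4) w] maxL xs(2) by blast
    obtain a b c where "a < L" "a \<noteq> 0" "xs ! a = x" "b < L" "b \<noteq> 0" "xs ! b = y"
      "c < L" "c \<noteq> 0" "xs ! c = z"
      using idx[OF xyz(1,4)] idx[OF xyz(2,5)] idx[OF xyz(3,6)] by blast
    then show ?thesis using xyz by (intro exI[of _ a] exI[of _ b] exI[of _ c]) auto
  qed
  have "\<exists>i. P i"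
  proof -
    obtain a b c where abc: "distinct [0, a, b, c]"
      "\<forall>k\<in>{a, b, c}. k < L \<and> E (xs0 ! 0) (xs0 ! k)"
      using three[OF xs0(1)] by (auto simp: L_def)
    have "\<exists>k\<in>{a, b, c}. 2 \<le> k" using abc(1) by auto
    then show ?thesis using abc(2) xs0(1) L_def unfolding P_def by blast
  qed
  then obtain i where i: "P i" and least: "\<And>k. P k \<Longrightarrow> i \<le> k"
    using LeastI_ex Least_le by metis
  have beyond: "\<exists>j. i < j \<and> j < L \<and> E (xs ! 0) (xs ! j)" if xs: "lpath E V xs" "length xs = L" for xs
  proof -
    obtain a b c where abc: "distinct [0, a, b, c]"
      "\<forall>k\<in>{a, b, c}. k < L \<and> E (xs ! 0) (xs ! k)"
      using three[OF xs] by blast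
    have "k = 0 \<or> k = 1 \<or> i \<le> k" if "k \<in> {a, b, c}" for k
    proof (cases "2 \<le> k")
      case True
      then show ?thesis using least[of k] that abc(2) xs unfolding P_def by blast
    qed linarith
    then have "a = 0 \<or> a = 1 \<or> i \<le> a" "b = 0 \<or> b = 1 \<or> i \<le> b" "c = 0 \<or> c = 1 \<or> i \<le> c"
      by simp_all
    \<comment> \<open>Of three distinct nonzero positions, each \<open>1\<close> or at least
      \<open>i\<close>, at most one is \<open>1\<close> and at most one is \<open>i\<close>.\<close>
    then have "i < a \<or> i < b \<or> i < c" using abc(1) by auto
    then show ?thesis using abc(2) by blast
  qed
  obtain xs where xs: "lpath E V xs" "length xs = L" "E (xs ! 0) (xs ! i)"
    using i unfolding P_def by blast
  have iL: "2 \<le> i" "i < L" using i unfolding P_def by blast+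
  let ?ys = "flip_prefix i xs"
  have ys: "lpath E V ?ys" "length ?ys = L"
    using lpath_flip_prefix[OF xs(1) \<open>symp E\<close> _ _ xs(3)] iL xs(2) by (simp_all add: length_flip_prefix)
  obtain j where j: "i < j" "j < L" "E (xs ! 0) (xs ! j)" using beyond[OF xs(1,2)] by blast
  obtain m where m: "i < m" "m < L" "E (?ys ! 0) (?ys ! m)" using beyond[OF ys] by blast
  \<comment> \<open>The flip puts the old vertex \<open>i - 1\<close> first and leaves the positions
    from \<open>i\<close> on unchanged.\<close>
  have "E (xs ! (i - 1)) (xs ! m)"
    using m iL xs(2) nth_flip_prefix[of i xs] by simp
  then show ?thesis using that[of xs i j m] xs j m iL by simp
qed

text \<open>Vertices are replaced by their positions on the path, so that the disjointness of drawn
  paths reduces to arithmetic with indices.\<close>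

locale drawn_path =
  fixes E :: "'a \<Rightarrow> 'a \<Rightarrow> bool" and V p A U xs
  assumes drawing: "outer_drawing E V p A U" and path: "lpath E V xs"
begin

definition edge_arc :: "nat \<times> nat \<Rightarrow> complex set" where
  "edge_arc e = A (xs ! fst e) (xs ! snd e)"

text \<open>Edges of the path itself count as chords too. Ordering the two positions gives each edge
  a single name, so different pairs are different edges.\<close>

definition chord :: "nat \<times> nat \<Rightarrow> bool" where
  "chord e \<longleftrightarrow> fst e < snd e \<and> snd e < length xs \<and> E (xs ! fst e) (xs ! snd e)"

definition ends :: "nat \<times> nat \<Rightarrow> nat set" where
  "ends e = {fst e, snd e}"

definition pt :: "nat \<Rightarrow> complex" where
  "pt k = p (xs ! k)"

definition segment :: "nat \<Rightarrow> nat \<Rightarrow> (nat \<times> nat) set" where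
  "segment a b = (\<lambda>k. (k, Suc k)) ` {a..<b}"

lemma nth_V: "k < length xs \<Longrightarrow> xs ! k \<in> V"
  using path nth_mem by (fastforce simp: lpath_def)

lemma nth_eq: "k < length xs \<Longrightarrow> l < length xs \<Longrightarrow> xs ! k = xs ! l \<longleftrightarrow> k = l"
  using path by (simp add: lpath_def nth_eq_iff_index_eq)

lemma chord_arcset: "chord e \<Longrightarrow> arcset (edge_arc e) (pt (fst e)) (pt (snd e))"
  using outer_drawing_edge(1)[OF drawing nth_V nth_V] by (simp add: chord_def edge_arc_def pt_def)

lemma chord_outer: "chord e \<Longrightarrow> edge_arc e \<inter> U = {}"
  using outer_drawing_edge(4)[OF drawing nth_V nth_V] by (simp add: chord_def edge_arc_def)

lemma chord_cross:
  assumes "chord e" "chord f" "e \<noteq> f"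
  shows "edge_arc e \<inter> edge_arc f \<subseteq> pt ` (ends e \<inter> ends f)"
proof -
  obtain a b c d where ef: "e = (a, b)" "f = (c, d)" by fastforce
  have l: "a < b" "b < length xs" "c < d" "d < length xs" "E (xs ! a) (xs ! b)" "E (xs ! c) (xs ! d)"
    using assms by (auto simp: ef chord_def)
  have eq: "xs ! k = xs ! k' \<longleftrightarrow> k = k'" if "k \<in> {a, b, c, d}" "k' \<in> {a, b, c, d}" for k k'
    using nth_eq[of k k'] that l by auto
  have "{xs ! a, xs ! b} \<noteq> {xs ! c, xs ! d}"
    using assms(3) l by (auto simp: doubleton_eq_iff eq ef)
  then have "edge_arc e \<inter> edge_arc f \<subseteq> p ` ({xs ! a, xs ! b} \<inter> {xs ! c, xs ! d})"
    using outer_drawing_cross[OF drawing nth_V nth_V nth_V nth_V, of a b c d] l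
    by (simp add: edge_arc_def ef)
  also have "{xs ! a, xs ! b} \<inter> {xs ! c, xs ! d} \<subseteq> (!) xs ` ({a, b} \<inter> {c, d})"
    using eq by auto
  finally show ?thesis by (auto simp: ends_def ef pt_def)
qed

lemma chords_cross:
  assumes K: "Ball K chord" "Ball L chord" "K \<inter> L = {}"
    and "\<Union> (ends ` K) \<inter> \<Union> (ends ` L) \<subseteq> T"
  shows "\<Union> (edge_arc ` K) \<inter> \<Union> (edge_arc ` L) \<subseteq> pt ` T"
proof
  fix z assume "z \<in> \<Union> (edge_arc ` K) \<inter> \<Union> (edge_arc ` L)"
  then obtain e f where ef: "e \<in> K" "f \<in> L" "z \<in> edge_arc e \<inter> edge_arc f" by blast
  then have "z \<in> pt ` (ends e \<inter> ends f)" using K chord_cross[of e f] by blast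
  then show "z \<in> pt ` T" using ef(1,2) assms(4) by blast
qed

lemma segment_chords: "b < length xs \<Longrightarrow> Ball (segment a b) chord"
  using path by (auto simp: segment_def chord_def lpath_def)

lemma segment_ends: "\<Union> (ends ` segment a b) \<subseteq> {a..b}"
  by (auto simp: segment_def ends_def)

lemma segment_arcset:
  assumes "a < b" "b < length xs"
  shows "arcset (\<Union> (edge_arc ` segment a b)) (pt a) (pt b)"
  using assms
proof (induction b)
  case (Suc b)
  have c: "chord (b, Suc b)" using segment_chords[of "Suc b" b] Suc.prems by (simp add: segment_def)
  note last = chord_arcset[OF c]
  have seg: "segment a (Suc b) = insert (b, Suc b) (segment a b)"
    using Suc.prems by (auto simp: segment_def atLeastLessThanSuc)
  show ?case
  proof (cases "a = b")
    case True
    then show ?thesis using last by (simp add: segment_def)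
  next
    case False
    then have IH: "arcset (\<Union> (edge_arc ` segment a b)) (pt a) (pt b)" using Suc by simp
    have "\<Union> (edge_arc ` segment a b) \<inter> \<Union> (edge_arc ` {(b, Suc b)}) \<subseteq> pt ` {b}"
    proof (rule chords_cross)
      show "Ball (segment a b) chord" using segment_chords[of b a] Suc.prems by simp
      show "Ball {(b, Suc b)} chord" using c by simp
      show "segment a b \<inter> {(b, Suc b)} = {}" by (auto simp: segment_def)
      show "\<Union> (ends ` segment a b) \<inter> \<Union> (ends ` {(b, Suc b)}) \<subseteq> {b}"
        using segment_ends[of a b] by (auto simp: ends_def)
    qed
    then have "arcset (\<Union> (edge_arc ` segment a b) \<union> edge_arc (b, Suc b)) (pt a) (pt (Suc b))"
      using arcset_join[OF IH, of "edge_arc (b, Suc b)" "pt (Suc b)"] last by simp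
    then show ?thesis using seg by (simp add: Un_commute)
  qed
qed simp

text \<open>The branch vertices \<open>a\<close>, \<open>b\<close>, \<open>c\<close>,
  \<open>d\<close> of the K4 subdivision are the positions \<open>0\<close>, \<open>i - 1\<close>,
  \<open>i\<close>, \<open>j\<close>. The path supplies \<open>ab\<close>, \<open>bc\<close> and
  \<open>cd\<close>, the chords at \<open>0\<close> supply \<open>ad\<close> and \<open>ac\<close>,
  and \<open>bd\<close> is the chord from \<open>i - 1\<close> to \<open>m\<close> followed by the
  path back to \<open>j\<close>. The last piece is empty if \<open>j = m\<close>;
  \<open>2 \<le> i\<close> keeps \<open>a\<close> and \<open>b\<close> apart.\<close>

lemma no_crossing_chords:
  assumes "2 \<le> i" "i < j" "j \<le> m" "m < length xs"
    and chords: "chord (0, i)" "chord (0, j)" "chord (i - 1, m)"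
  shows False
proof -
  let ?U = "\<lambda>K. \<Union> (edge_arc ` K)" and ?I = "\<lambda>K. \<Union> (ends ` K)"
  let ?ab = "segment 0 (i - 1)" and ?bc = "{(i - 1, i)}" and ?cd = "segment i j" and ?ad = "{(0, j)}"
    and ?ac = "{(0, i)}" and ?bd = "insert (i - 1, m) (segment j m)"
  have bc: "chord (i - 1, i)"
    using path assms(1-4) by (auto simp: chord_def lpath_def dest: spec[of _ "i - 1"])
  have ch: "Ball ?ab chord" "Ball ?bc chord" "Ball ?cd chord" "Ball ?ad chord" "Ball ?ac chord"
    "Ball ?bd chord"
    using segment_chords[of "i - 1" 0] segment_chords[of j i] segment_chords[of m j] assms bc by simp_all
  have I: "?I ?ab \<subseteq> {0..i - 1}" "?I ?bc \<subseteq> {i - 1, i}" "?I ?cd \<subseteq> {i..j}" "?I ?ad \<subseteq> {0, j}"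
    "?I ?ac \<subseteq> {0, i}" "?I ?bd \<subseteq> {i - 1} \<union> {j..m}"
    using segment_ends[of 0 "i - 1"] segment_ends[of i j] segment_ends[of j m] assms(3)
    by (auto simp: ends_def)
  have X: "?U K \<inter> ?U L \<subseteq> pt ` T"
    if "Ball K chord" "Ball L chord" "K \<inter> L = {}" "?I K \<subseteq> S" "?I L \<subseteq> S'" "S \<inter> S' \<subseteq> T"
    for K L S S' T
    using chords_cross[of K L T] that by blast
  have AB: "arcset (?U ?ab) (pt 0) (pt (i - 1))" using segment_arcset assms by simp
  have BC: "arcset (?U ?bc) (pt (i - 1)) (pt i)" using chord_arcset[OF bc] by simp
  have CD: "arcset (?U ?cd) (pt i) (pt j)" using segment_arcset assms by simp
  have AD: "arcset (?U ?ad) (pt 0) (pt j)" using chord_arcset[OF chords(2)] by simp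
  have AC: "arcset (?U ?ac) (pt 0) (pt i)" using chord_arcset[OF chords(1)] by simp
  have BD: "arcset (?U ?bd) (pt (i - 1)) (pt j)"
  proof (cases "j = m")
    case True
    then show ?thesis using chord_arcset[OF chords(3)] by (simp add: segment_def)
  next
    case False
    then have s: "arcset (?U (segment j m)) (pt m) (pt j)"
      using segment_arcset[of j m] assms arcset_sym by simp
    have "?U {(i - 1, m)} \<inter> ?U (segment j m) \<subseteq> pt ` {m}"
      by (rule X[of _ _ "{i - 1, m}" "{j..m}"])
        (use chords(3) segment_chords segment_ends assms in \<open>auto simp: segment_def ends_def\<close>)
    then have "arcset (?U {(i - 1, m)} \<union> ?U (segment j m)) (pt (i - 1)) (pt j)"
      using arcset_join[OF _ s] chord_arcset[OF chords(3)] by simp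
    then show ?thesis by simp
  qed
  have x: "?U ?ab \<inter> ?U ?bc \<subseteq> pt ` {i - 1}" "?U ?cd \<inter> ?U ?ad \<subseteq> pt ` {j}"
    "?U ?ab \<inter> ?U ?ad \<subseteq> pt ` {0}" "?U ?bc \<inter> ?U ?cd \<subseteq> pt ` {i}"
    "?U ?ab \<inter> ?U ?cd \<subseteq> pt ` {}" "?U ?bc \<inter> ?U ?ad \<subseteq> pt ` {}"
    by (rule X[OF ch(1,2) _ I(1,2)] X[OF ch(3,4) _ I(3,4)] X[OF ch(1,4) _ I(1,4)]
        X[OF ch(2,3) _ I(2,3)] X[OF ch(1,3) _ I(1,3)] X[OF ch(2,4) _ I(2,4)];
        use assms(1-4) in \<open>auto simp: segment_def\<close>)+
  have y: "?U ?ac \<inter> ?U ?ab \<subseteq> pt ` {0}" "?U ?ac \<inter> ?U ?ad \<subseteq> pt ` {0}"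
    "?U ?ac \<inter> ?U ?bc \<subseteq> pt ` {i}" "?U ?ac \<inter> ?U ?cd \<subseteq> pt ` {i}"
    by (rule X[OF ch(5,1) _ I(5,1)] X[OF ch(5,4) _ I(5,4)] X[OF ch(5,2) _ I(5,2)]
        X[OF ch(5,3) _ I(5,3)]; use assms(1-4) in \<open>auto simp: segment_def\<close>)+
  have z: "?U ?bd \<inter> ?U ?ab \<subseteq> pt ` {i - 1}" "?U ?bd \<inter> ?U ?bc \<subseteq> pt ` {i - 1}"
    "?U ?bd \<inter> ?U ?cd \<subseteq> pt ` {j}" "?U ?bd \<inter> ?U ?ad \<subseteq> pt ` {j}" "?U ?ac \<inter> ?U ?bd \<subseteq> pt ` {}"
    by (rule X[OF ch(6,1) _ I(6,1)] X[OF ch(6,2) _ I(6,2)] X[OF ch(6,3) _ I(6,3)]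
        X[OF ch(6,4) _ I(6,4)] X[OF ch(5,6) _ I(5,6)]; use assms(1-4) in \<open>auto simp: segment_def\<close>)+
  have outer: "U \<inter> ?U K = {}" if "Ball K chord" for K using that chord_outer by blast
  have inV: "xs ! 0 \<in> V" "xs ! (i - 1) \<in> V" "xs ! i \<in> V" "xs ! j \<in> V"
    by (rule nth_V, use assms(1-4) in linarith)+
  have cl: "{pt 0, pt (i - 1), pt i, pt j} \<subseteq> closure U"
    using outer_drawing_global(4)[OF drawing] inV by (auto simp: pt_def)
  show False
  proof (rule no_outerplanar_K4[OF AB BC CD AD AC BD])
    show "Topological_Spaces.connected U" "\<not> bounded U" using outer_drawing_global[OF drawing] by blast+
    show "U \<inter> (?U ?ab \<union> ?U ?bc \<union> ?U ?cd \<union> ?U ?ad \<union> ?U ?ac \<union> ?U ?bd) = {}"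
      unfolding Int_Un_distrib outer[OF ch(1)] outer[OF ch(2)] outer[OF ch(3)] outer[OF ch(4)]
        outer[OF ch(5)] outer[OF ch(6)] by simp
  qed (use x y z cl in \<open>simp_all only: image_insert image_empty subset_empty\<close>)
qed

end

lemma outer_drawing_deg_le2:
  assumes d: "outer_drawing E V p A U" and "finite V" "V \<noteq> {}" "symp E" "\<And>x. \<not> E x x"
  shows "\<exists>v\<in>V. deg_le2 E V v"
proof (rule ccontr)
  assume "\<not> ?thesis"
  then obtain xs i j m where xs: "lpath E V xs" and i: "2 \<le> i" "i < j" "i < m"
    "j < length xs" "m < length xs"
    and ch: "E (xs ! 0) (xs ! i)" "E (xs ! 0) (xs ! j)" "E (xs ! (i - 1)) (xs ! m)"
    using min_degree_3_chords[OF assms(2-5)] by metis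
  show False
  proof (cases "j \<le> m")
    case True
    interpret drawn_path E V p A U xs using d xs by unfold_locales
    have "i - 1 < m" using i by linarith
    then show False using no_crossing_chords[of i j m] True i ch by (simp add: chord_def)
  next
    case False
    \<comment> \<open>The flip exchanges the vertices at positions \<open>0\<close> and
      \<open>i - 1\<close>, hence the roles of \<open>j\<close> and \<open>m\<close>. The old path
      edge from \<open>i - 1\<close> to \<open>i\<close> becomes the chord
      \<open>(0, i)\<close>.\<close>
    let ?ys = "flip_prefix i xs"
    have il: "i < length xs" using i by simp
    have ys: "lpath E V ?ys" using lpath_flip_prefix[OF xs \<open>symp E\<close> _ il ch(1)] i by simp
    interpret drawn_path E V p A U ?ys using d ys by unfold_locales
    note nth = nth_flip_prefix[OF il]
    have "E (xs ! (i - 1)) (xs ! i)" using xs i unfolding lpath_def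
      by (metis Suc_diff_1 il less_le_trans zero_less_numeral)
    moreover have "i - 1 < j" using i by linarith
    ultimately show False using no_crossing_chords[of i m j] False i ch
      by (simp add: chord_def nth length_flip_prefix)
  qed
qed

text \<open>Edges and arcs change from step to step and are generalised in the induction, while
  \<open>U\<close> stays the same under deletion and elimination.\<close>

theorem outer_drawing_tw2:
  assumes "outer_drawing E V p A U" "finite V" "symp E" "\<And>x. \<not> E x x"
  shows "tw2 V E"
  using assms
proof (induction "card V" arbitrary: V E A)
  case 0
  then show ?case by (simp add: tw2_empty)
next
  case (Suc n)
  then have "V \<noteq> {}" by auto
  then obtain v where v: "v \<in> V" "deg_le2 E V v"
    using outer_drawing_deg_le2[OF Suc.prems(1,2)] Suc.prems(3,4) by blast
  have card: "n = card (V - {v})" using Suc.hyps(2) v(1) Suc.prems(2) by simp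
  have "tw2 (V - {v}) E"
    using Suc.hyps(1)[OF card outer_drawing_subset[OF Suc.prems(1) Diff_subset]] Suc.prems by simp
  moreover have "\<not> eliminate v E x x" for x using Suc.prems(4) by (simp add: eliminate_def)
  then have "tw2 (V - {v}) (eliminate v E)"
    using Suc.hyps(1)[OF card outer_drawing_eliminate[OF Suc.prems(1) v(1) Suc.prems(3) v(2)]]
      symp_eliminate[OF Suc.prems(3)] Suc.prems(2) by simp
  ultimately show ?case by (rule tw2_step[OF v])
qed

section \<open>Graphs as digraphs\<close>

lemma dominates_induce_iff: "u \<rightarrow>\<^bsub>G \<restriction> S\<^esub> v \<longleftrightarrow> u \<rightarrow>\<^bsub>G\<^esub> v \<and> u \<in> S \<and> v \<in> S"
  by (auto simp: arcs_ends_conv)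

text \<open>The reachability of digraphs is reflexive only on the vertices, \<open>rtrancl\<close>
  everywhere; the conjunct \<open>x \<in> S\<close> accounts for the difference.\<close>

lemma reachable_induce_iff:
  "x \<rightarrow>\<^sup>*\<^bsub>G \<restriction> S\<^esub> y \<longleftrightarrow> x \<in> S \<and> (x, y) \<in> (edges_on (dominates G) S)\<^sup>*"
proof
  assume "x \<rightarrow>\<^sup>*\<^bsub>G \<restriction> S\<^esub> y"
  then have "(x, y) \<in> rtrancl_on S (arcs_ends (G \<restriction> S))" by (simp add: reachable_def)
  then show "x \<in> S \<and> (x, y) \<in> (edges_on (dominates G) S)\<^sup>*"
  proof (induction rule: rtrancl_on_induct)
    case (step y z)
    have "(y, z) \<in> edges_on (dominates G) S"
      using step.hyps(2) unfolding dominates_induce_iff by (simp add: edges_on_def)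
    then show ?case using step.IH by (meson rtrancl.rtrancl_into_rtrancl)
  qed simp
next
  assume "x \<in> S \<and> (x, y) \<in> (edges_on (dominates G) S)\<^sup>*"
  then have "x \<in> S" "(x, y) \<in> (edges_on (dominates G) S)\<^sup>*" by blast+
  from this(2) have "(x, y) \<in> rtrancl_on S (arcs_ends (G \<restriction> S))"
  proof (induction rule: rtrancl_induct)
    case base
    then show ?case using \<open>x \<in> S\<close> by simp
  next
    case (step y z)
    then have "y \<rightarrow>\<^bsub>G \<restriction> S\<^esub> z" "z \<in> S" unfolding dominates_induce_iff by (simp_all add: edges_on_def)
    then show ?case using step.IH by (meson rtrancl_on_into_rtrancl_on)
  qed
  then show "x \<rightarrow>\<^sup>*\<^bsub>G \<restriction> S\<^esub> y" by (simp add: reachable_def)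
qed

lemma edges_on_class:
  assumes "(x, y) \<in> (edges_on (mono_edges E t) V)\<^sup>*"
  shows "(x, y) \<in> (edges_on E {z \<in> V. t z = t x})\<^sup>*"
proof -
  have "t y = t x \<and> (x, y) \<in> (edges_on E {z \<in> V. t z = t x})\<^sup>*"
    using assms
  proof (induction rule: rtrancl_induct)
    case (step y z)
    then have "(y, z) \<in> edges_on E {z \<in> V. t z = t x}" "t z = t x"
      by (auto simp: edges_on_def mono_edges_def)
    then show ?case using step.IH by (meson rtrancl.rtrancl_into_rtrancl)
  qed simp
  then show ?thesis by blast
qed

lemma tree_labelling_iff_classes:
  "tree_labelling E V t \<longleftrightarrow> (\<forall>i\<in>t ` V. acyclic_on E {x \<in> V. t x = i} \<and>
     (\<forall>x\<in>{x \<in> V. t x = i}. \<forall>y\<in>{x \<in> V. t x = i}. (x, y) \<in> (edges_on E {x \<in> V. t x = i})\<^sup>*))"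
  (is "_ \<longleftrightarrow> ?R")
proof
  assume lab: "tree_labelling E V t"
  show ?R
  proof (intro ballI conjI)
    fix i assume "i \<in> t ` V"
    show "acyclic_on E {x \<in> V. t x = i}"
      by (rule acyclic_on_subset[of "mono_edges E t" V])
        (use lab in \<open>auto simp: tree_labelling_def mono_edges_def\<close>)
    fix x y assume "x \<in> {x \<in> V. t x = i}" "y \<in> {x \<in> V. t x = i}"
    then show "(x, y) \<in> (edges_on E {x \<in> V. t x = i})\<^sup>*"
      using lab edges_on_class[of x y E t V] unfolding tree_labelling_def by auto
  qed
next
  assume R: ?R
  show "tree_labelling E V t"
    unfolding tree_labelling_def
  proof (intro conjI ballI impI)
    show "acyclic_on (mono_edges E t) V"
      unfolding acyclic_on_def
    proof (intro allI impI)
      fix S assume S: "S \<subseteq> V" "S \<noteq> {}"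
      then obtain s where s: "s \<in> S" by blast
      \<comment> \<open>It suffices to look at the part of \<open>S\<close> in one class, because
        monochromatic edges do not leave it.\<close>
      let ?S = "{x \<in> S. t x = t s}"
      have "acyclic_on E {x \<in> V. t x = t s}" using R s S by blast
      moreover have "?S \<subseteq> {x \<in> V. t x = t s}" "?S \<noteq> {}" using S s by auto
      ultimately obtain x where x: "x \<in> ?S" "\<forall>y\<in>?S. \<forall>z\<in>?S. E x y \<and> E x z \<longrightarrow> y = z"
        unfolding acyclic_on_def by meson
      have "y \<in> ?S \<and> E x y" if "y \<in> S" "mono_edges E t x y" for y
        using that x(1) by (simp add: mono_edges_def)
      then show "\<exists>x\<in>S. \<forall>y\<in>S. \<forall>z\<in>S. mono_edges E t x y \<and> mono_edges E t x z \<longrightarrow> y = z"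
        using x by (intro bexI[of _ x]) (meson, simp)
    qed
  next
    fix x y assume xy: "x \<in> V" "y \<in> V" "t x = t y"
    then have "(x, y) \<in> (edges_on E {z \<in> V. t z = t x})\<^sup>*" using R by simp
    then show "(x, y) \<in> (edges_on (mono_edges E t) V)\<^sup>*"
      by (rule edges_on_rtrancl_mono) (auto simp: mono_edges_def)
  qed
qed

context graph
begin

abbreviation adj :: "'a \<Rightarrow> 'a \<Rightarrow> bool" where
  "adj \<equiv> dominates G"

lemma symp_adj: "symp adj"
  using graph_symmetric by (intro sympI) blast

lemma irreflp_adj: "\<not> adj x x"
  using adj_not_same by blast

text \<open>By symmetry the strong components of the white graph are its reachability classes, so
  the component in the rule must be the class of \<open>w\<close>.\<close>

lemma psd_forces_iff:
  assumes B: "B \<subseteq> verts G"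
  shows "psd_forces G B u w \<longleftrightarrow> forces adj (verts G) B u w"
proof -
  let ?S = "verts G - B"
  let ?R = "(edges_on adj ?S)\<^sup>*"
  let ?H = "G \<restriction> ?S"
  have sym: "(y, x) \<in> ?R" if "(x, y) \<in> ?R" for x y
    using edges_on_rtrancl_sym[OF symp_adj that] .
  have comp: "W = {x. (w, x) \<in> ?R} \<and> w \<in> ?S" if W: "W \<in> pre_digraph.sccs_verts ?H" "w \<in> W" for W w
  proof -
    have 1: "x \<rightarrow>\<^sup>*\<^bsub>?H\<^esub> y" if "x \<in> W" "y \<in> W" for x y
      using W(1) that unfolding pre_digraph.sccs_verts_def by blast
    have 2: "y \<in> W" if "x \<in> W" "x \<rightarrow>\<^sup>*\<^bsub>?H\<^esub> y" "y \<rightarrow>\<^sup>*\<^bsub>?H\<^esub> x" for x y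
      using W(1) that unfolding pre_digraph.sccs_verts_def by blast
    have w: "w \<in> ?S" using 1[OF W(2,2)] unfolding reachable_induce_iff by blast
    have "x \<in> W" if x: "(w, x) \<in> ?R" for x
    proof (rule 2[OF W(2)])
      show "w \<rightarrow>\<^sup>*\<^bsub>?H\<^esub> x" using x w unfolding reachable_induce_iff by blast
      show "x \<rightarrow>\<^sup>*\<^bsub>?H\<^esub> w"
        using sym[OF x] edges_on_rtrancl_mem[OF x w] unfolding reachable_induce_iff by blast
    qed
    moreover have "(w, x) \<in> ?R" if "x \<in> W" for x
      using 1[OF W(2) that] unfolding reachable_induce_iff by blast
    ultimately show ?thesis using w by blast
  qed
  have scc: "{x. (w, x) \<in> ?R} \<in> pre_digraph.sccs_verts ?H" if w: "w \<in> ?S" for w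
    unfolding pre_digraph.sccs_verts_def
  proof (intro CollectI conjI ballI allI impI)
    show "{x. (w, x) \<in> ?R} \<noteq> {}" by blast
  next
    fix x y assume "x \<in> {x. (w, x) \<in> ?R}" "y \<in> {x. (w, x) \<in> ?R}"
    then have "(x, w) \<in> ?R" "(w, y) \<in> ?R" "x \<in> ?S"
      using sym edges_on_rtrancl_mem[of w x] w by blast+
    then show "x \<rightarrow>\<^sup>*\<^bsub>?H\<^esub> y" unfolding reachable_induce_iff by (meson rtrancl_trans)
  next
    fix x y assume "x \<in> {x. (w, x) \<in> ?R}" "y \<notin> {x. (w, x) \<in> ?R}"
    then have "(w, x) \<in> ?R" "(w, y) \<notin> ?R" by simp_all
    then have "(x, y) \<notin> ?R" using rtrancl_trans[of w x _ y] by blast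
    then have "\<not> x \<rightarrow>\<^sup>*\<^bsub>?H\<^esub> y" unfolding reachable_induce_iff by blast
    then show "\<not> x \<rightarrow>\<^sup>*\<^bsub>?H\<^esub> y \<or> \<not> y \<rightarrow>\<^sup>*\<^bsub>?H\<^esub> x" by blast
  qed
  have nb: "{x \<in> ?S. u \<rightarrow>\<^bsub>G \<restriction> (B \<union> W)\<^esub> x} = {x \<in> W. adj u x}" if "u \<in> B" "W \<subseteq> ?S" for W
    using that unfolding dominates_induce_iff by blast
  show ?thesis
  proof
    assume "psd_forces G B u w"
    then obtain W where u: "u \<in> B" and W: "W \<in> pre_digraph.sccs_verts ?H" "w \<in> W"
      and nbw: "{x \<in> ?S. u \<rightarrow>\<^bsub>G \<restriction> (B \<union> W)\<^esub> x} = {w}"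
      unfolding psd_forces_def by blast
    have eq: "W = {x. (w, x) \<in> ?R}" and w: "w \<in> ?S" using comp[OF W] by blast+
    have "W \<subseteq> ?S" unfolding eq using edges_on_rtrancl_mem[OF _ w] by blast
    then have "{x \<in> W. adj u x} = {w}" using nb[OF u] nbw by simp
    then have "adj u w" "\<And>x. (w, x) \<in> ?R \<Longrightarrow> adj u x \<Longrightarrow> x = w" unfolding eq by blast+
    then show "forces adj (verts G) B u w" unfolding forces_def using u w by blast
  next
    assume f: "forces adj (verts G) B u w"
    let ?W = "{x. (w, x) \<in> ?R}"
    have u: "u \<in> B" and w: "w \<in> ?S" and uw: "adj u w"
      and uniq: "\<And>x. (w, x) \<in> ?R \<Longrightarrow> adj u x \<Longrightarrow> x = w"
      using f unfolding forces_def by blast+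
    have "?W \<subseteq> ?S" using edges_on_rtrancl_mem[OF _ w] by blast
    then have "{x \<in> ?S. u \<rightarrow>\<^bsub>G \<restriction> (B \<union> ?W)\<^esub> x} = {x \<in> ?W. adj u x}" by (rule nb[OF u])
    also have "\<dots> = {w}" using uw uniq by blast
    finally have nbw: "{x \<in> ?S. u \<rightarrow>\<^bsub>G \<restriction> (B \<union> ?W)\<^esub> x} = {w}" .
    show "psd_forces G B u w"
      unfolding psd_forces_def
    proof (intro conjI bexI[OF _ scc[OF w]])
      show "w \<in> ?W" by simp
    qed (fact u nbw)+
  qed
qed

lemma psd_forcing_process_iff:
  assumes "B \<subseteq> verts G"
  shows "psd_forcing_process G B fs \<longleftrightarrow> process adj (verts G) B fs"
  using assms
proof (induction fs arbitrary: B)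
  case (Cons f fs)
  obtain u w where f: "f = (u, w)" by fastforce
  have "psd_forcing_process G (insert w B) fs \<longleftrightarrow> process adj (verts G) (insert w B) fs"
    if "forces adj (verts G) B u w"
    using Cons.IH[of "insert w B"] Cons.prems that unfolding forces_def by blast
  then show ?case unfolding f using psd_forces_iff[OF Cons.prems] by auto
qed simp

lemma connected_induce_iff:
  assumes "S \<subseteq> verts G"
  shows "Digraph_Component.connected (G \<restriction> S) \<longleftrightarrow>
    S \<noteq> {} \<and> (\<forall>x\<in>S. \<forall>y\<in>S. (x, y) \<in> (edges_on adj S)\<^sup>*)"
proof -
  interpret H: sym_digraph "G \<restriction> S" using induced_graph_imp_graph induced_induce assms by blast
  show ?thesis
    unfolding connected_def strongly_connected_def
    unfolding H.reachable_mk_symmetric_eq[OF H.sym_arcs] reachable_induce_iff by simp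
qed

section \<open>Cycles as arc walks versus vertices of degree at most one\<close>

lemma awalk_of_vertices:
  assumes "v \<in> verts G" "\<And>k. k < length vs \<Longrightarrow> adj ((v # vs) ! k) (vs ! k)"
  shows "\<exists>q. awalk v q (last (v # vs)) \<and> map (head G) q = vs"
  using assms
proof (induction vs arbitrary: v)
  case Nil
  then show ?case by (intro exI[of _ "[]"]) (simp add: awalk_Nil_iff)
next
  case (Cons w vs)
  have "adj v w" using Cons.prems(2)[of 0] by simp
  then obtain e where e: "e \<in> arcs G" "tail G e = v" "head G e = w" by blast
  have "adj ((w # vs) ! k) (vs ! k)" if "k < length vs" for k
    using Cons.prems(2)[of "Suc k"] that by simp
  then obtain q where "awalk w q (last (w # vs))" "map (head G) q = vs"
    using Cons.IH[of w] e(1,3) by auto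
  then show ?case using e by (intro exI[of _ "e # q"]) (simp add: awalk_Cons_iff)
qed

text \<open>On the vertex set of the cycle every vertex is adjacent to its predecessor and its
  successor. These differ exactly because the length is at least three.\<close>

lemma acyclic_imp_no_long_cycle:
  assumes ac: "acyclic_on adj (verts G)" and c: "cycle q" "length q \<ge> 3"
  shows False
proof -
  obtain u where q: "awalk u q u" "distinct (tl (awalk_verts u q))" "q \<noteq> []"
    using c(1) unfolding cycle_def by blast
  have cas: "cas u q u" and arcs: "set q \<subseteq> arcs G" using q(1) unfolding awalk_def by blast+
  define ys where "ys = map (head G) q"
  have ys: "distinct ys" "length ys = length q"
    using q(2) awalk_verts_conv'[OF cas] q(3) by (simp_all add: ys_def)
  have chain: "k < length p \<Longrightarrow> cas a p b \<Longrightarrow> tail G (p ! k) = (if k = 0 then a else head G (p ! (k - 1)))"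
    for k a p b
  proof (induction p arbitrary: a k)
    case (Cons e p)
    then show ?case by (cases k) (auto split: if_splits)
  qed simp
  have lst: "p \<noteq> [] \<Longrightarrow> cas a p b \<Longrightarrow> head G (last p) = b" for a p b
    by (induction p arbitrary: a) (auto split: if_splits)
  have pred: "adj (ys ! (if k = 0 then length q - 1 else k - 1)) (ys ! k)" if k: "k < length q" for k
  proof -
    have "q ! k \<in> arcs G" using arcs k by (meson nth_mem subsetD)
    then have "adj (tail G (q ! k)) (head G (q ! k))" by (simp add: in_arcs_imp_in_arcs_ends)
    moreover have "tail G (q ! k) = ys ! (if k = 0 then length q - 1 else k - 1)"
      using chain[OF k cas] lst[OF q(3) cas] q(3) k by (simp add: ys_def last_conv_nth)
    ultimately show ?thesis using k by (simp add: ys_def)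
  qed
  have "set ys \<subseteq> verts G" using arcs by (auto simp: ys_def)
  moreover have "set ys \<noteq> {}" using q(3) by (simp add: ys_def)
  ultimately obtain x where x: "x \<in> set ys" "\<forall>y\<in>set ys. \<forall>z\<in>set ys. adj x y \<and> adj x z \<longrightarrow> y = z"
    using ac unfolding acyclic_on_def by meson
  then obtain k where k: "k < length q" "x = ys ! k" using ys(2) by (metis in_set_conv_nth)
  let ?l = "if k = 0 then length q - 1 else k - 1" and ?r = "if k = length q - 1 then 0 else k + 1"
  have lr: "?l < length q" "?r < length q" "?l \<noteq> ?r" using k(1) c(2) by auto
  have "adj (ys ! k) (ys ! ?l)" using pred[OF k(1)] sympD[OF symp_adj] by blast
  moreover have "adj (ys ! k) (ys ! ?r)"
  proof -
    have "(if ?r = 0 then length q - 1 else ?r - 1) = k" by auto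
    then show ?thesis using pred[OF lr(2)] by simp
  qed
  ultimately have "ys ! ?l = ys ! ?r" using x(2) lr ys(2) k(2) by (metis nth_mem)
  then show False using lr ys by (simp add: nth_eq_iff_index_eq)
qed

text \<open>If every vertex of \<open>S\<close> has two neighbours in \<open>S\<close>, the first
  vertex of a longest path has a neighbour at a position \<open>k \<ge> 2\<close>, and this edge
  closes a cycle of length \<open>k + 1\<close>.\<close>

lemma no_long_cycle_imp_acyclic:
  assumes "\<And>q. cycle q \<Longrightarrow> length q < 3"
  shows "acyclic_on adj (verts G)"
  unfolding acyclic_on_def
proof (intro allI impI, rule ccontr)
  fix S assume S: "S \<subseteq> verts G" "S \<noteq> {}"
    and neg: "\<not> (\<exists>x\<in>S. \<forall>y\<in>S. \<forall>z\<in>S. adj x y \<and> adj x z \<longrightarrow> y = z)"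
  have two: "\<exists>y\<in>S. \<exists>z\<in>S. adj x y \<and> adj x z \<and> y \<noteq> z" if "x \<in> S" for x
    using neg that by blast
  have "finite S" using S(1) finite_verts finite_subset by blast
  then obtain xs where xs: "lpath adj S xs" "xs \<noteq> []"
    and max: "\<And>ys. lpath adj S ys \<Longrightarrow> length ys \<le> length xs"
    using longest_lpath_exists[OF _ S(2)] by blast
  have x0: "xs ! 0 \<in> S" using xs by (cases xs) (auto simp: lpath_def)
  then obtain y z where yz: "y \<in> S" "z \<in> S" "adj (xs ! 0) y" "adj (xs ! 0) z" "y \<noteq> z"
    using two by blast
  obtain a where a: "0 < a" "a < length xs" "xs ! a = y"
    using longest_lpath_neighbour[OF xs max symp_adj irreflp_adj yz(1,3)] by blast
  obtain b where b: "0 < b" "b < length xs" "xs ! b = z"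
    using longest_lpath_neighbour[OF xs max symp_adj irreflp_adj yz(2,4)] by blast
  have "a \<noteq> b" using a b yz(5) by auto
  then have "2 \<le> a \<or> 2 \<le> b" using a(1) b(1) by linarith
  then obtain k where k: "2 \<le> k" "k < length xs" "adj (xs ! 0) (xs ! k)"
    using a(2,3) b(2,3) yz(3,4) by blast
  define v where "v = xs ! 0"
  \<comment> \<open>The heads of the arcs of the closed walk: positions \<open>1\<close> to
    \<open>k\<close>, then the start again.\<close>
  define vs where "vs = tl (take (Suc k) xs) @ [v]"
  have take: "take (Suc k) xs = v # tl (take (Suc k) xs)"
    using xs(2) by (cases xs) (simp_all add: v_def)
  have len: "length vs = Suc k" using k(2) by (simp add: vs_def)
  have eq: "v # vs = take (Suc k) xs @ [v]" unfolding vs_def using take by simp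
  have nth: "(v # vs) ! l = xs ! l" if "l \<le> k" for l
    unfolding eq using that k(2) by (simp add: nth_append)
  have adj: "adj ((v # vs) ! l) (vs ! l)" if "l < length vs" for l
  proof (cases "l = k")
    case True
    have "vs ! k = v" unfolding vs_def using k(2) by (simp add: nth_append)
    moreover have "(v # vs) ! k = xs ! k" by (rule nth) simp
    ultimately show ?thesis using True k(3) sympD[OF symp_adj] by (simp add: v_def)
  next
    case False
    then have l: "Suc l \<le> k" using that len by simp
    have "vs ! l = xs ! Suc l" using nth[OF l] by simp
    moreover have "(v # vs) ! l = xs ! l" using nth[of l] l by simp
    ultimately show ?thesis using xs(1) l k(2) by (simp add: lpath_def)
  qed
  obtain q where q: "awalk v q (last (v # vs))" "map (head G) q = vs"
    using awalk_of_vertices[OF _ adj] x0 S(1) by (auto simp: v_def)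
  have "last (v # vs) = v" by (simp add: vs_def)
  then have aw: "awalk v q v" using q(1) by simp
  have "q \<noteq> []" using q(2) len by auto
  have "distinct (take (Suc k) xs)" using xs(1) by (simp add: lpath_def)
  then have "distinct vs" unfolding vs_def by (subst (asm) take) simp
  moreover have "cas v q v" using aw unfolding awalk_def by blast
  ultimately have "distinct (tl (awalk_verts v q))"
    using awalk_verts_conv' q(2) \<open>q \<noteq> []\<close> by simp
  then have "cycle q" unfolding cycle_def using aw \<open>q \<noteq> []\<close> by blast
  moreover have "length q = Suc k" using q(2) len by (metis length_map)
  ultimately show False using assms[of q] k(1) by simp
qed

lemma undirected_tree_induce_iff:
  assumes S: "S \<subseteq> verts G"
  shows "undirected_tree (G \<restriction> S) \<longleftrightarrow>
    S \<noteq> {} \<and> (\<forall>x\<in>S. \<forall>y\<in>S. (x, y) \<in> (edges_on adj S)\<^sup>*) \<and> acyclic_on adj S"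
proof -
  have "induced_subgraph (G \<restriction> S) G" using S by (rule induced_induce)
  then have "digraph (G \<restriction> S)" "sym_digraph (G \<restriction> S)"
    using digraphI_induced induced_graph_imp_graph by blast+
  then interpret H: graph "G \<restriction> S"
    unfolding graph_def pseudo_graph_def digraph_def by blast
  have "acyclic_on H.adj S \<longleftrightarrow> acyclic_on adj S"
    using acyclic_on_subset[of adj S S H.adj] acyclic_on_subset[of H.adj S S adj]
    unfolding dominates_induce_iff by blast
  moreover have "acyclic_on H.adj S \<longleftrightarrow> \<not> (\<exists>q. H.cycle q \<and> length q \<ge> 3)"
    using H.acyclic_imp_no_long_cycle H.no_long_cycle_imp_acyclic
    unfolding induce_subgraph_verts by (meson not_le)
  ultimately show ?thesis
    unfolding undirected_tree_def connected_induce_iff[OF S] by blast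
qed

section \<open>Tree covers as labellings, and the two inequalities\<close>

lemma induced_subgraph_eq: "induced_subgraph T G \<Longrightarrow> T = G \<restriction> verts T"
  unfolding induced_subgraph_def subgraph_def compatible_def induce_subgraph_def
  by (intro pre_digraph.equality) auto

lemma tree_cover_of_labelling:
  assumes "tree_labelling adj (verts G) t"
  shows "tree_cover G ((\<lambda>i. G \<restriction> {x \<in> verts G. t x = i}) ` t ` verts G)"
proof -
  let ?C = "\<lambda>i. {x \<in> verts G. t x = i}"
  have "induced_subgraph (G \<restriction> ?C i) G \<and> undirected_tree (G \<restriction> ?C i)" if i: "i \<in> t ` verts G" for i
  proof -
    have C: "?C i \<subseteq> verts G" "?C i \<noteq> {}" using i by auto
    have "acyclic_on adj (?C i) \<and> (\<forall>x\<in>?C i. \<forall>y\<in>?C i. (x, y) \<in> (edges_on adj (?C i))\<^sup>*)"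
      using assms i unfolding tree_labelling_iff_classes by blast
    then show ?thesis
      using C(2) induced_induce[OF C(1)] unfolding undirected_tree_induce_iff[OF C(1)] by blast
  qed
  moreover have "pairwise (\<lambda>S T. verts S \<inter> verts T = {}) ((\<lambda>i. G \<restriction> ?C i) ` t ` verts G)"
    unfolding pairwise_image pairwise_def by auto
  ultimately show ?thesis unfolding tree_cover_def by auto
qed

text \<open>The label of a vertex is the tree that contains it, so the set of labels is the cover
  itself and the forcing trees can be compared with it directly.\<close>

lemma labelling_of_tree_cover:
  assumes cover: "tree_cover G \<T>"
  obtains t where "tree_labelling adj (verts G) t" "t ` verts G = \<T>"
    "\<And>T. T \<in> \<T> \<Longrightarrow> G \<restriction> {x \<in> verts G. t x = T} = T"
proof -
  have ind: "induced_subgraph T G" "undirected_tree T" if "T \<in> \<T>" for T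
    using cover that unfolding tree_cover_def by blast+
  have disj: "S = T" if "S \<in> \<T>" "T \<in> \<T>" "x \<in> verts S" "x \<in> verts T" for S T x
    using cover that unfolding tree_cover_def pairwise_def by blast
  have union: "(\<Union>T\<in>\<T>. verts T) = verts G" using cover unfolding tree_cover_def by blast
  define t where "t x = (THE T. T \<in> \<T> \<and> x \<in> verts T)" for x
  have t: "t x = T" if "T \<in> \<T>" "x \<in> verts T" for x T
    unfolding t_def using that disj by blast
  have mem: "t x \<in> \<T> \<and> x \<in> verts (t x)" if x: "x \<in> verts G" for x
  proof -
    obtain T where T: "T \<in> \<T>" "x \<in> verts T" using x unfolding union[symmetric] by blast
    then show ?thesis using t[OF T] by simp
  qed
  have sub: "verts T \<subseteq> verts G" if "T \<in> \<T>" for T using union that by blast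
  have cls: "{x \<in> verts G. t x = T} = verts T" if T: "T \<in> \<T>" for T
    using t[OF T] mem sub[OF T] by blast
  have eq: "G \<restriction> verts T = T" if "T \<in> \<T>" for T
    using induced_subgraph_eq[OF ind(1)[OF that]] by simp
  have tree: "verts T \<noteq> {}" "\<forall>x\<in>verts T. \<forall>y\<in>verts T. (x, y) \<in> (edges_on adj (verts T))\<^sup>*"
    "acyclic_on adj (verts T)" if "T \<in> \<T>" for T
    using ind(2)[OF that] undirected_tree_induce_iff[OF sub[OF that]] unfolding eq[OF that] by blast+
  have img: "t ` verts G = \<T>"
  proof
    show "t ` verts G \<subseteq> \<T>" using mem by blast
    show "\<T> \<subseteq> t ` verts G"
    proof
      fix T assume T: "T \<in> \<T>"
      \<comment> \<open>Connected digraphs are nonempty, so each tree of the cover occurs as a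
        label.\<close>
      then obtain x where "x \<in> verts T" using tree(1) by blast
      then show "T \<in> t ` verts G" using t[OF T] sub[OF T] by blast
    qed
  qed
  have "tree_labelling adj (verts G) t"
    unfolding tree_labelling_iff_classes img using cls tree(2,3) by simp
  then show ?thesis using that img cls eq by simp
qed

lemma outerplanar_tw2:
  assumes "outerplanar G"
  shows "tw2 (verts G) adj"
proof -
  obtain p c where pe: "planar_embedding G p c"
    and fr: "p ` verts G \<subseteq> frontier (outside (drawing G p c))"
    using assms unfolding outerplanar_def by blast
  define D where "D = drawing G p c"
  \<comment> \<open>A representative arc for each ordered pair of adjacent vertices; the embedding
    gives opposite arcs the same image, so the picture of an edge is symmetric.\<close>
  define e where "e x y = (SOME e. e \<in> arcs G \<and> tail G e = x \<and> head G e = y)" for x y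
  have e: "e x y \<in> arcs G" "tail G (e x y) = x" "head G (e x y) = y" if "adj x y" for x y
  proof -
    have "\<exists>e. e \<in> arcs G \<and> tail G e = x \<and> head G e = y" using that by blast
    then have "e x y \<in> arcs G \<and> tail G (e x y) = x \<and> head G (e x y) = y"
      unfolding e_def by (rule someI_ex)
    then show "e x y \<in> arcs G" "tail G (e x y) = x" "head G (e x y) = y" by blast+
  qed
  note pe' = pe[unfolded planar_embedding_def]
  note inj = conjunct1[OF pe'] and arc = conjunct1[OF conjunct2[OF pe']]
    and cross = conjunct2[OF conjunct2[OF pe']]
  have imgD: "path_image (c e) \<subseteq> D" if "e \<in> arcs G" for e
    using that unfolding D_def drawing_def by blast
  have "bounded D"
    unfolding D_def drawing_def bounded_Un
  proof
    show "bounded (p ` verts G)" by (simp add: finite_imp_bounded)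
    show "bounded (\<Union>e\<in>arcs G. path_image (c e))"
      using arc by (intro bounded_UN) (simp_all add: bounded_arc_image)
  qed
  then have U: "Topological_Spaces.connected (outside D)" "\<not> bounded (outside D)"
    by (simp_all add: connected_outside unbounded_outside)
  have "outer_drawing adj (verts G) p (\<lambda>x y. path_image (c (e x y))) (outside D)"
    unfolding outer_drawing_def
  proof (intro conjI ballI impI)
    show "p ` verts G \<subseteq> closure (outside D)" using fr unfolding D_def frontier_def by blast
  next
    fix x y assume xy: "adj x y"
    then have yx: "adj y x" using sympD[OF symp_adj] by blast
    note exy = e[OF xy] and eyx = e[OF yx]
    show "arcset (path_image (c (e x y))) (p x) (p y)"
      unfolding arcset_def using bspec[OF arc exy(1)] exy by auto
    show "path_image (c (e x y)) = path_image (c (e y x))"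
      using bspec[OF bspec[OF cross exy(1)] eyx(1)] exy eyx by (simp add: insert_commute)
    show "path_image (c (e x y)) \<inter> p ` verts G = {p x, p y}" using bspec[OF arc exy(1)] exy by simp
    show "path_image (c (e x y)) \<inter> outside D = {}"
      using imgD[OF exy(1)] outside_no_overlap[of D] by blast
  next
    fix x y x' y' assume h: "adj x y \<and> adj x' y' \<and> {x, y} \<noteq> {x', y'}"
    then have "adj x y" "adj x' y'" by blast+
    note e1 = e[OF this(1)] and e2 = e[OF this(2)]
    show "path_image (c (e x y)) \<inter> path_image (c (e x' y')) \<subseteq> p ` ({x, y} \<inter> {x', y'})"
      using bspec[OF bspec[OF cross e1(1)] e2(1)] h unfolding e1(2,3) e2(2,3) by simp
  qed (fact inj U)+
  then show ?thesis
    using outer_drawing_tw2 finite_verts symp_adj irreflp_adj by blast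
qed

lemma tree_cover_realized:
  assumes "outerplanar G" "tree_cover G \<T>"
  obtains Z fs where "psd_forcing_set G Z" "card Z = card \<T>" "psd_forcing_process G Z fs"
    "forcing_tree G fs ` Z = \<T>"
proof -
  obtain t where lab: "tree_labelling adj (verts G) t" and img: "t ` verts G = \<T>"
    and cls: "\<And>T. T \<in> \<T> \<Longrightarrow> G \<restriction> {x \<in> verts G. t x = T} = T"
    using labelling_of_tree_cover[OF assms(2)] by blast
  obtain Z fs where r: "realizes adj (verts G) t Z fs"
    using tw2_realizes[OF outerplanar_tw2[OF assms(1)] symp_adj irreflp_adj lab] by blast
  then have pr: "process adj (verts G) Z fs" and inj: "inj_on t Z" and tZ: "t ` Z = \<T>"
    unfolding realizes_def img by blast+
  have Z: "Z \<subseteq> verts G" using process_subset[OF pr] .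
  have pr': "psd_forcing_process G Z fs" using pr psd_forcing_process_iff[OF Z] by blast
  have "card Z = card \<T>" using card_image[OF inj] tZ by simp
  moreover have "psd_forcing_set G Z" unfolding psd_forcing_set_def using Z pr' by blast
  moreover have "forcing_tree G fs z = t z" if z: "z \<in> Z" for z
    unfolding forcing_tree_def realizes_class[OF r z] using cls tZ z by blast
  then have "forcing_tree G fs ` Z = \<T>" unfolding tZ[symmetric] by simp
  ultimately show ?thesis using that pr' by blast
qed

lemma tree_cover_of_psd_forcing_set:
  assumes "psd_forcing_set G Z"
  obtains \<T> where "tree_cover G \<T>" "card \<T> \<le> card Z"
proof -
  obtain fs where Z: "Z \<subseteq> verts G" and "psd_forcing_process G Z fs"
    using assms unfolding psd_forcing_set_def by blast
  then have "process adj (verts G) Z fs" using psd_forcing_process_iff by blast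
  then obtain t where t: "tree_labelling adj (verts G) t" "t ` verts G \<subseteq> Z"
    using process_tree_labelling[OF _ symp_adj irreflp_adj] by blast
  have fin: "finite Z" using Z finite_verts finite_subset by blast
  have "card ((\<lambda>i. G \<restriction> {x \<in> verts G. t x = i}) ` t ` verts G) \<le> card (t ` verts G)"
    by (rule card_image_le) simp
  also have "\<dots> \<le> card Z" using fin t(2) by (rule card_mono)
  finally show ?thesis using that tree_cover_of_labelling[OF t(1)] by blast
qed

text \<open>The cover by single vertices shows that the minimum is taken over a nonempty
  set.\<close>

lemma tree_cover_number_attained:
  obtains \<T> where "tree_cover G \<T>" "card \<T> = tree_cover_number G"
proof -
  have "tree_labelling adj (verts G) id" using irreflp_adj by (rule tree_labelling_id)
  then have "\<exists>k. \<exists>\<T>. tree_cover G \<T> \<and> card \<T> = k" using tree_cover_of_labelling by blast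
  then have "\<exists>\<T>. tree_cover G \<T> \<and> card \<T> = tree_cover_number G"
    unfolding tree_cover_number_def by (rule LeastI_ex)
  then show ?thesis using that by blast
qed

lemma psd_forcing_number_eq:
  assumes "outerplanar G"
  shows "Z\<^sub>+ G = tree_cover_number G"
proof (rule antisym)
  obtain \<T> where T: "tree_cover G \<T>" "card \<T> = tree_cover_number G"
    using tree_cover_number_attained by blast
  obtain Z where Z: "psd_forcing_set G Z" "card Z = tree_cover_number G"
    using tree_cover_realized[OF assms T(1)] T(2) by metis
  then show "Z\<^sub>+ G \<le> tree_cover_number G" unfolding psd_forcing_number_def by (intro Least_le) blast
  have "\<exists>Z. psd_forcing_set G Z \<and> card Z = Z\<^sub>+ G"
    unfolding psd_forcing_number_def by (rule LeastI_ex) (use Z in blast)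
  then obtain Z' where Z': "psd_forcing_set G Z'" "card Z' = Z\<^sub>+ G" by blast
  obtain \<T>' where T': "tree_cover G \<T>'" "card \<T>' \<le> Z\<^sub>+ G"
    using tree_cover_of_psd_forcing_set[OF Z'(1)] Z'(2) by metis
  have "tree_cover_number G \<le> card \<T>'"
    unfolding tree_cover_number_def by (rule Least_le) (use T'(1) in blast)
  then show "tree_cover_number G \<le> Z\<^sub>+ G" using T'(2) by simp
qed

end

theorem theorem6p23:
  fixes G :: "('a,'b) pre_digraph"
  assumes "graph G" and "outerplanar G"
  shows "Z\<^sub>+ G = tree_cover_number G \<and>
    (\<forall>\<T>. tree_cover G \<T> \<and> card \<T> = tree_cover_number G \<longrightarrow>
      (\<exists>Z fs. psd_forcing_set G Z \<and> card Z = Z\<^sub>+ G \<and>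
        psd_forcing_process G Z fs \<and> forcing_tree G fs ` Z = \<T>))"
proof -
  interpret graph G by (fact assms(1))
  note eq = psd_forcing_number_eq[OF assms(2)]
  have "\<exists>Z fs. psd_forcing_set G Z \<and> card Z = Z\<^sub>+ G \<and>
      psd_forcing_process G Z fs \<and> forcing_tree G fs ` Z = \<T>"
    if "tree_cover G \<T>" "card \<T> = tree_cover_number G" for \<T>
    using tree_cover_realized[OF assms(2) that(1)] that(2) eq by metis
  then show ?thesis using eq by blast
qed

end
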